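(* Assume the independence and boundedness conditions in the context. Fix $t\ge2$, two fixed models $f_1,f_2$ with $|f_\lambda(\bm x)|\le M$, and $\delta\in(0,1)$. Run the adaptive rolling window comparison procedure (context) with $\delta'=\delta/(3t)$. Then there is a universal constant $C>0$ such that, with probability at least $1-\delta$, its output $\widehat f\in\{f_1,f_2\}$ satisfies \[ \mathcal{E}_t(\widehat f)\le C\Big[\min\{\mathcal{E}_t(f_1),\mathcal{E}_t(f_2)\}+M^2\log(t/\delta)\min_{\ell\in[t-1]}\Big\{\max_{t-\ell\le j\le t-1}\operatorname{TV}(P_j,P_t)+\frac1{n_{t,\ell}}\Big\}\Big]. \]
   Context: Setting: for each period $j\in\mathbb{Z}_+$, $P_j$ is a distribution of $(\bm x,y)\in\mathcal X\times\mathbb R$, $\mathcal X\subseteq\mathbb R^d$. Validation data $\mathcal{D}^{\mathrm{va}}_j=\{(\bm x^{\mathrm{va}}_{j,i},y^{\mathrm{va}}_{j,i})\}_{i=1}^{n_j}$ ($n_j\ge1$) are i.i.d. from $P_j$ and independent across $j$. Boundedness: there is $M\ge1$ with $|y|\le M$ a.s. under every $P_j$. $L_j(f)=\mathbb E_{P_j}[(f(\bm x)-y)^2]$, $f_t^*=\mathbb E_{P_t}[y\mid\bm x=\cdot]$, $\mathcal E_t(f)=L_t(f)-L_t(f_t^* )$, $\operatorname{TV}(P,Q)=\sup_A|P(A)-Q(A)|$, $[n]=\{1,\dots,n\}$. Comparison procedure (inputs $f_1,f_2$, data $\{\mathcal D^{\mathrm{va}}_j\}_{j=1}^{t-1}$,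 $\delta'$, $M$): let $u_{j,i}=[f_1(\bm x^{\mathrm{va}}_{j,i})-y^{\mathrm{va}}_{j,i}]^2-[f_2(\bm x^{\mathrm{va}}_{j,i})-y^{\mathrm{va}}_{j,i}]^2$. For $\ell\in[t-1]$: $n_{t,\ell}=\sum_{j=t-\ell}^{t-1}n_j$, $\widehat\Delta_{t,\ell}=\frac1{n_{t,\ell}}\sum_{j=t-\ell}^{t-1}\sum_{i=1}^{n_j}u_{j,i}$, $\widehat v_{t,\ell}^2=\frac{1}{n_{t,\ell}-1}\sum_{j=t-\ell}^{t-1}\sum_{i=1}^{n_j}(u_{j,i}-\widehat\Delta_{t,\ell})^2$; $\widehat\psi(t,\ell,\delta')=8M^2$ if $n_{t,\ell}=1$, and otherwise $\widehat\psi(t,\ell,\delta')=\widehat v_{t,\ell}\sqrt{2\log(2/\delta')/n_{t,\ell}}+\frac{64M^2\log(2/\delta')}{3(n_{t,\ell}-1)}$; $\widehat\phi(t,\ell,\delta')=\max_{i\in[\ell]}\big(|\widehat\Delta_{t,\ell}-\widehat\Delta_{t,i}|-[\widehat\psi(t,\ell,\delta')+\widehat\psi(t,i,\delta')]\big)_+$. Choose $\widehat\ell\in\mathrm{argmin}_{\ell\in[t-1]}\{\widehat\phi(t,\ell,\delta')+\widehat\psi(t,\ell,\delta')\}$ and output $f_1$ if $\widehat\Delta_{t,\widehat\ell}\le0$, else $f_2$. *)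

theory Defs
  imports "HOL-Probability.Probability"
begin

text \<open>Covariates: X is a subset of R^d; we embed R^d into the fixed type nat => real
  (vectors whose coordinates k >= d vanish), so that the universal constant
  can be quantified uniformly over all dimensions d.\<close>

type_synonym covar = "nat \<Rightarrow> real"

text \<open>Validation data of all periods: D (j,i) = (x_{j,i}, y_{j,i}).\<close>
type_synonym dataset = "nat \<times> nat \<Rightarrow> covar \<times> real"

definition risk :: "(covar \<times> real) measure \<Rightarrow> (covar \<Rightarrow> real) \<Rightarrow> real" where
  "risk P f = (\<integral>z. (f (fst z) - snd z)^2 \<partial>P)"

definition bayes_risk :: "(covar \<times> real) measure \<Rightarrow> real" where
  "bayes_risk P =
     (\<integral>z. (real_cond_exp P (vimage_algebra (space P) fst borel) snd z - snd z)^2 \<partial>P)"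

definition excess_risk :: "(covar \<times> real) measure \<Rightarrow> (covar \<Rightarrow> real) \<Rightarrow> real" where
  "excess_risk P f = risk P f - bayes_risk P"

definition tv_dist :: "'a measure \<Rightarrow> 'a measure \<Rightarrow> real" where
  "tv_dist P Q = (SUP A\<in>sets P. \<bar>measure P A - measure Q A\<bar>)"

definition u_val :: "(covar \<Rightarrow> real) \<Rightarrow> (covar \<Rightarrow> real) \<Rightarrow> dataset \<Rightarrow> nat \<Rightarrow> nat \<Rightarrow> real" where
  "u_val f1 f2 D j i = (f1 (fst (D (j,i))) - snd (D (j,i)))^2 - (f2 (fst (D (j,i))) - snd (D (j,i)))^2"

definition n_win :: "(nat \<Rightarrow> nat) \<Rightarrow> nat \<Rightarrow> nat \<Rightarrow> nat" where
  "n_win n t l = (\<Sum>j\<in>{t-l..t-1}. n j)"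

definition Delta_hat :: "(covar \<Rightarrow> real) \<Rightarrow> (covar \<Rightarrow> real) \<Rightarrow> dataset \<Rightarrow> (nat \<Rightarrow> nat) \<Rightarrow> nat \<Rightarrow> nat \<Rightarrow> real" where
  "Delta_hat f1 f2 D n t l =
     (\<Sum>j\<in>{t-l..t-1}. \<Sum>i\<in>{1..n j}. u_val f1 f2 D j i) / real (n_win n t l)"

definition v_hat :: "(covar \<Rightarrow> real) \<Rightarrow> (covar \<Rightarrow> real) \<Rightarrow> dataset \<Rightarrow> (nat \<Rightarrow> nat) \<Rightarrow> nat \<Rightarrow> nat \<Rightarrow> real" where
  "v_hat f1 f2 D n t l = sqrt
     ((\<Sum>j\<in>{t-l..t-1}. \<Sum>i\<in>{1..n j}. (u_val f1 f2 D j i - Delta_hat f1 f2 D n t l)^2)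
       / (real (n_win n t l) - 1))"

definition psi_hat :: "(covar \<Rightarrow> real) \<Rightarrow> (covar \<Rightarrow> real) \<Rightarrow> dataset \<Rightarrow> (nat \<Rightarrow> nat) \<Rightarrow> real \<Rightarrow> real \<Rightarrow> nat \<Rightarrow> nat \<Rightarrow> real" where
  "psi_hat f1 f2 D n M \<delta>' t l =
     (if n_win n t l = 1 then 8 * M^2
      else v_hat f1 f2 D n t l * sqrt (2 * ln (2 / \<delta>') / real (n_win n t l))
           + 64 * M^2 * ln (2 / \<delta>') / (3 * (real (n_win n t l) - 1)))"

definition phi_hat :: "(covar \<Rightarrow> real) \<Rightarrow> (covar \<Rightarrow> real) \<Rightarrow> dataset \<Rightarrow> (nat \<Rightarrow> nat) \<Rightarrow> real \<Rightarrow> real \<Rightarrow> nat \<Rightarrow> nat \<Rightarrow> real" where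
  "phi_hat f1 f2 D n M \<delta>' t l =
     Max ((\<lambda>i. max 0 (\<bar>Delta_hat f1 f2 D n t l - Delta_hat f1 f2 D n t i\<bar>
                      - (psi_hat f1 f2 D n M \<delta>' t l + psi_hat f1 f2 D n M \<delta>' t i))) ` {1..l})"

definition crit :: "(covar \<Rightarrow> real) \<Rightarrow> (covar \<Rightarrow> real) \<Rightarrow> dataset \<Rightarrow> (nat \<Rightarrow> nat) \<Rightarrow> real \<Rightarrow> real \<Rightarrow> nat \<Rightarrow> nat \<Rightarrow> real" where
  "crit f1 f2 D n M \<delta>' t l = phi_hat f1 f2 D n M \<delta>' t l + psi_hat f1 f2 D n M \<delta>' t l"

definition is_lhat :: "(covar \<Rightarrow> real) \<Rightarrow> (covar \<Rightarrow> real) \<Rightarrow> dataset \<Rightarrow> (nat \<Rightarrow> nat) \<Rightarrow> real \<Rightarrow> real \<Rightarrow> nat \<Rightarrow> nat \<Rightarrow> bool" where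
  "is_lhat f1 f2 D n M \<delta>' t l \<longleftrightarrow> l \<in> {1..t-1} \<and>
     (\<forall>l'\<in>{1..t-1}. crit f1 f2 D n M \<delta>' t l \<le> crit f1 f2 D n M \<delta>' t l')"

definition compare_out :: "(covar \<Rightarrow> real) \<Rightarrow> (covar \<Rightarrow> real) \<Rightarrow> dataset \<Rightarrow> (nat \<Rightarrow> nat) \<Rightarrow> nat \<Rightarrow> nat \<Rightarrow> (covar \<Rightarrow> real)" where
  "compare_out f1 f2 D n t l = (if Delta_hat f1 f2 D n t l \<le> 0 then f1 else f2)"

definition data_law :: "(nat \<Rightarrow> (covar \<times> real) measure) \<Rightarrow> (nat \<Rightarrow> nat) \<Rightarrow> nat \<Rightarrow> dataset measure" where
  "data_law P n t = PiM {(j,i). j \<in> {1..t-1} \<and> i \<in> {1..n j}} (\<lambda>(j,i). P j)"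

end

theory Submission
  imports Defs
begin

text \<open>
  Write $\psi$ for the empirical Bernstein radius and $\Delta_t = \mathcal{E}_t(f_1) - \mathcal{E}_t(f_2)$.
  On an event of probability at least $1-\delta$ every window mean lies within $\psi$ of its
  expectation, and the empirical second moment in each window is at most twice its expectation plus
  a term of order $M^4\log(t/\delta)$.
  The Lepski-type rule then gives $|\hat\Delta_{\hat\ell} - \Delta_t| \le 3\psi_\ell + O(M^2\tau_\ell)$
  for every window $\ell$, where $\tau_\ell$ is its maximal total variation distance to $P_t$.
  The second moment of the loss difference under $P_t$ is at most
  $32M^2(\mathcal{E}_t(f_1)+\mathcal{E}_t(f_2)) = 32M^2(2\min_\lambda\mathcal{E}_t(f_\lambda)+|\Delta_t|)$,
  so AM-GM turns $\psi_\ell$ into a small multiple of $\min_\lambda\mathcal{E}_t(f_\lambda)+|\Delta_t|$ plus the fast rate,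
  and choosing the wrong model requires $|\Delta_t| \le |\hat\Delta_{\hat\ell} - \Delta_t|$.
\<close>

text \<open>The radius \<open>psi_hat\<close> is prescribed, with leading constant sqrt 2 and
  remainder 64 M^2 log(2/\<delta>') / (3 (n - 1)), so the empirical Bernstein inequality has to meet
  exactly these constants. Loss differences lie in an interval of length 8 M^2; after rescaling to
  [0,1] the remainder has the constant 8/3, which leaves so little room that explicit numerics are
  used. The second obstacle is that pooled observations are independent but not identically
  distributed. The sample variance then follows the spread about the pooled mean, which dominates
  the average of the individual variances, so the error is on the safe side. As
  \<open>psi_hat\<close> is itself random, the upper tail of the empirical second moment is what
  makes it comparable with population quantities. Drift enters twice, through the mean and through
  the second moment; the latter costs a multiple of sqrt(M^4 \<tau> L / n), which AM-GM splits into
  M^2 \<tau> and M^2 L / n, so no slower rate appears.\<close>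

section \<open>Exponential moment bounds\<close>

text \<open>For nonnegative \<open>x\<close> this is the Pade bound e^x <= (2 + x) / (2 - x) = 1 + x
  + x^2 / (2 - x). The factor 1 / (2 - l) makes the tails sub-gamma with scale 1/2, the origin of
  the term L / 2 in \<open>bernstein_upper_tail\<close>.\<close>

lemma exp_le_quadratic_sub_gamma:
  fixes x l :: real
  assumes "x \<le> l" "0 \<le> l" "l < 2"
  shows "exp x \<le> 1 + x + x\<^sup>2 / (2 - l)"
proof (cases "x \<ge> 0")
  case True
  define g where "g = (\<lambda>x::real. (2 + x) - (2 - x) * exp x)"
  have "g 0 \<le> g x"
  proof (rule DERIV_nonneg_imp_nondecreasing[OF True])
    fix z :: real assume "0 \<le> z"
    have "(g has_real_derivative 1 - (1 - z) * exp z) (at z)"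
      unfolding g_def by (auto intro!: derivative_eq_intros simp: algebra_simps)
    moreover have "(1 - z) * exp z \<le> exp (-z) * exp z"
      using exp_ge_add_one_self[of "-z"] by (intro mult_right_mono) auto
    ultimately show "\<exists>y. (g has_real_derivative y) (at z) \<and> 0 \<le> y"
      by (intro exI[of _ "1 - (1 - z) * exp z"]) (simp add: exp_minus)
  qed
  then have "(2 - x) * exp x \<le> 2 + x"
    by (simp add: g_def)
  then have "exp x \<le> 1 + x + x\<^sup>2 / (2 - x)"
    using assms by (simp add: field_simps power2_eq_square)
  also have "x\<^sup>2 / (2 - x) \<le> x\<^sup>2 / (2 - l)"
    using assms by (intro divide_left_mono mult_pos_pos) auto
  finally show ?thesis by simp
next
  case False
  define g where "g = (\<lambda>x::real. 1 + x + x\<^sup>2 / 2 - exp x)"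
  have "g x \<ge> g 0"
  proof (rule DERIV_nonpos_imp_nonincreasing[of x 0 g])
    show "x \<le> 0" using False by simp
  next
    fix z :: real
    have "(g has_real_derivative 1 + z - exp z) (at z)"
      unfolding g_def by (auto intro!: derivative_eq_intros)
    moreover have "1 + z - exp z \<le> 0"
      using exp_ge_add_one_self[of z] by linarith
    ultimately show "\<exists>y. (g has_real_derivative y) (at z) \<and> y \<le> 0" by blast
  qed
  then have "exp x \<le> 1 + x + x\<^sup>2 / 2" by (simp add: g_def)
  also have "x\<^sup>2 / 2 \<le> x\<^sup>2 / (2 - l)"
    using assms by (intro divide_left_mono) auto
  finally show ?thesis by simp
qed

corollary exp_le_quadratic_nonpos: "x \<le> 0 \<Longrightarrow> exp x \<le> 1 + x + x\<^sup>2 / (2::real)"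
  using exp_le_quadratic_sub_gamma[of x 0] by simp

context prob_space
begin

lemma integrable_AE_bounded:
  fixes f :: "'a \<Rightarrow> real"
  assumes "f \<in> borel_measurable M" "AE x in M. \<bar>f x\<bar> \<le> B"
  shows "integrable M f"
  using assms by (intro integrable_const_bound[where B = B]) auto

text \<open>Exponential Markov with a separate exponent \<open>b i\<close> for every summand,
  because the laws differ between periods. All three tail bounds below are instances.\<close>

lemma chernoff_indep_vars:
  fixes Z :: "'i \<Rightarrow> 'a \<Rightarrow> real"
  assumes fin: "finite I"
    and indep: "indep_vars (\<lambda>_. borel) Z I"
    and int: "\<And>i. i \<in> I \<Longrightarrow> integrable M (\<lambda>x. exp (Z i x))"
    and mgf: "\<And>i. i \<in> I \<Longrightarrow> expectation (\<lambda>x. exp (Z i x)) \<le> exp (b i)"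
  shows "\<P>(x in M. \<tau> \<le> (\<Sum>i\<in>I. Z i x)) \<le> exp ((\<Sum>i\<in>I. b i) - \<tau>)"
proof -
  have rv[measurable]: "\<And>i. i \<in> I \<Longrightarrow> random_variable borel (Z i)"
    using indep by (simp add: indep_vars_def)
  have ind: "indep_vars (\<lambda>_. borel) (\<lambda>i x. exp (Z i x)) I"
    by (rule indep_vars_compose2[OF indep]) simp
  have "\<P>(x in M. \<tau> \<le> (\<Sum>i\<in>I. Z i x)) = \<P>(x in M. exp \<tau> \<le> (\<Prod>i\<in>I. exp (Z i x)))"
    using fin by (simp add: exp_sum[symmetric])
  also have "\<dots> \<le> expectation (\<lambda>x. \<Prod>i\<in>I. exp (Z i x)) / exp \<tau>"
    by (rule integral_Markov_inequality_measure[where A = "{}"])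
       (auto intro!: indep_vars_integrable[OF fin ind int] AE_I2 prod_nonneg)
  also have "expectation (\<lambda>x. \<Prod>i\<in>I. exp (Z i x)) = (\<Prod>i\<in>I. expectation (\<lambda>x. exp (Z i x)))"
    by (rule indep_vars_lebesgue_integral[OF fin ind int])
  also have "\<dots> \<le> (\<Prod>i\<in>I. exp (b i))"
    by (intro prod_mono conjI mgf integral_nonneg_AE) auto
  finally show ?thesis
    using fin by (simp add: exp_sum exp_diff divide_right_mono)
qed

lemma mgf_centred_le:
  fixes Y :: "'a \<Rightarrow> real"
  assumes [measurable]: "random_variable borel Y"
    and bd: "AE x in M. \<bar>Y x\<bar> \<le> 1" and mean: "expectation Y = 0"
    and l: "0 \<le> l" "l < 2"
  shows "expectation (\<lambda>x. exp (l * Y x)) \<le> exp (expectation (\<lambda>x. (Y x)\<^sup>2) * l\<^sup>2 / (2 - l))"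
proof -
  have int: "integrable M Y" "integrable M (\<lambda>x. (Y x)\<^sup>2)"
    using bd by (auto intro!: integrable_AE_bounded[where B = 1] simp: abs_square_le_1)
  have "expectation (\<lambda>x. exp (l * Y x)) \<le> expectation (\<lambda>x. 1 + l * Y x + l\<^sup>2 / (2 - l) * (Y x)\<^sup>2)"
  proof (rule integral_mono_AE)
    show "integrable M (\<lambda>x. exp (l * Y x))"
    proof (rule integrable_AE_bounded[where B = "exp l"])
      show "AE x in M. \<bar>exp (l * Y x)\<bar> \<le> exp l"
        using bd by eventually_elim (use l in \<open>auto intro: mult_left_le\<close>)
    qed auto
    show "AE x in M. exp (l * Y x) \<le> 1 + l * Y x + l\<^sup>2 / (2 - l) * (Y x)\<^sup>2"
      using bd
    proof eventually_elim
      case (elim x)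
      then have "l * Y x \<le> l"
        using l by (intro mult_left_le) auto
      from exp_le_quadratic_sub_gamma[OF this l] show ?case
        by (simp add: power_mult_distrib)
    qed
  qed (use int in auto)
  also have "\<dots> = 1 + l\<^sup>2 / (2 - l) * expectation (\<lambda>x. (Y x)\<^sup>2)"
    using int mean by (simp add: prob_space)
  also have "\<dots> \<le> exp (l\<^sup>2 / (2 - l) * expectation (\<lambda>x. (Y x)\<^sup>2))"
    by simp
  finally show ?thesis by (simp add: mult.commute)
qed

text \<open>The proxy \<open>v\<close> may exceed the true variance:
  \<open>empirical_bernstein_unit\<close> inserts the spread about the pooled mean. At the chosen
  \<open>l\<close> the exponent v l^2 / (2 - l) - l \<tau> equals -L exactly.\<close>

lemma bernstein_upper_tail:
  fixes X :: "'i \<Rightarrow> 'a \<Rightarrow> real"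
  assumes fin: "finite I"
    and indep: "indep_vars (\<lambda>_. borel) X I"
    and mean: "\<And>i. i \<in> I \<Longrightarrow> expectation (X i) = 0"
    and bd: "\<And>i. i \<in> I \<Longrightarrow> AE x in M. \<bar>X i x\<bar> \<le> 1"
    and v: "(\<Sum>i\<in>I. expectation (\<lambda>x. (X i x)\<^sup>2)) \<le> v" "0 < v" and L: "0 < L"
  shows "\<P>(x in M. sqrt (2 * v * L) + L / 2 \<le> (\<Sum>i\<in>I. X i x)) \<le> exp (- L)"
proof -
  have [measurable]: "\<And>i. i \<in> I \<Longrightarrow> random_variable borel (X i)"
    using indep by (simp add: indep_vars_def)
  \<comment> \<open>the minimiser of the sub-gamma exponent\<close>
  define r where "r = sqrt (2 * L / v)"
  define l where "l = r / (1 + r / 2)"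
  have r: "r > 0" "r\<^sup>2 = 2 * L / v" using v L by (auto simp: r_def)
  have l: "0 < l" "l < 2" using r by (auto simp: l_def field_simps)
  have ind: "indep_vars (\<lambda>_. borel) (\<lambda>i x. l * X i x) I"
    by (rule indep_vars_compose2[OF indep]) simp
  have int: "integrable M (\<lambda>x. exp (l * X i x))" if "i \<in> I" for i
  proof (rule integrable_AE_bounded[where B = "exp l"])
    show "AE x in M. \<bar>exp (l * X i x)\<bar> \<le> exp l"
      using bd[OF that] by eventually_elim (use l in \<open>auto intro: mult_left_le\<close>)
  qed (use that in auto)
  define \<tau> where "\<tau> = sqrt (2 * v * L) + L / 2"
  have "v * r = sqrt (2 * v * L)"
  proof -
    have "(v * r)\<^sup>2 = 2 * v * L" using r v by (simp add: power_mult_distrib power2_eq_square field_simps)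
    then show ?thesis using v r by (metis real_sqrt_unique less_imp_le mult_pos_pos)
  qed
  then have tau: "\<tau> = v * r + L / 2" by (simp add: \<tau>_def)
  have vr: "v * r * r = 2 * L" using r v by (simp add: power2_eq_square field_simps)
  have "l * \<tau> * (1 + r / 2) = r * \<tau>" using r by (simp add: l_def field_simps)
  also have "\<dots> = 2 * L + L * r / 2" using vr by (simp add: tau algebra_simps)
  finally have e1: "l * \<tau> = (2 * L + L * r / 2) / (1 + r / 2)" using r by (simp add: field_simps)
  have "2 - l = 2 / (1 + r / 2)" using r by (simp add: l_def field_simps)
  then have "v * l\<^sup>2 / (2 - l) = v * r * r / (2 * (1 + r / 2))"
    using r(1) by (simp add: l_def power2_eq_square divide_simps)
  also have "\<dots> = L / (1 + r / 2)"
    unfolding vr by (rule mult_divide_mult_cancel_left) simp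
  finally have e2: "v * l\<^sup>2 / (2 - l) = L / (1 + r / 2)" .
  have e: "v * l\<^sup>2 / (2 - l) - l * \<tau> = - L"
    unfolding e1 e2 diff_divide_distrib[symmetric] using r(1) by (simp add: divide_eq_eq algebra_simps)
  have "\<P>(x in M. \<tau> \<le> (\<Sum>i\<in>I. X i x)) = \<P>(x in M. l * \<tau> \<le> (\<Sum>i\<in>I. l * X i x))"
    using l by (simp add: sum_distrib_left[symmetric])
  also have "\<dots> \<le> exp ((\<Sum>i\<in>I. expectation (\<lambda>x. (X i x)\<^sup>2) * l\<^sup>2 / (2 - l)) - l * \<tau>)"
    by (intro chernoff_indep_vars fin ind int mgf_centred_le mean bd) (use l in auto)
  also have "\<dots> \<le> exp (v * l\<^sup>2 / (2 - l) - l * \<tau>)"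
    using v l by (simp add: sum_divide_distrib[symmetric] sum_distrib_right[symmetric]
        divide_right_mono mult_right_mono)
  also have "\<dots> = exp (- L)" by (simp add: e)
  finally show ?thesis by (simp add: \<tau>_def)
qed

text \<open>Self-bounding argument: Y^2 <= m^2 Y replaces the second moment of \<open>Y i\<close> by
  its mean, so the lower deviation is governed by \<open>S\<close> and \<open>m\<close> alone and
  has no lower-order term. Applied to squared deviations it bounds the sample variance from below
  without fourth moments.\<close>

lemma nonneg_sum_lower_tail:
  fixes Y :: "'i \<Rightarrow> 'a \<Rightarrow> real"
  assumes fin: "finite I"
    and indep: "indep_vars (\<lambda>_. borel) Y I"
    and bd: "\<And>i. i \<in> I \<Longrightarrow> AE x in M. 0 \<le> Y i x \<and> Y i x \<le> m\<^sup>2"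
    and S: "S = (\<Sum>i\<in>I. expectation (Y i))" "0 < S" and m: "0 < m" and L: "0 < L"
  shows "\<P>(x in M. (\<Sum>i\<in>I. Y i x) \<le> S - m * sqrt (2 * S * L)) \<le> exp (- L)"
proof -
  have [measurable]: "\<And>i. i \<in> I \<Longrightarrow> random_variable borel (Y i)"
    using indep by (simp add: indep_vars_def)
  \<comment> \<open>The minimiser of l^2 m^2 S / 2 - l \<tau>; the two terms become L and 2
    L.\<close>
  define l where "l = sqrt (2 * L / S) / m"
  have l: "0 < l" using S L m by (simp add: l_def)
  define \<tau> where "\<tau> = m * sqrt (2 * S * L)"
  have lt: "l * \<tau> = 2 * L"
  proof -
    have "l * \<tau> = sqrt ((2 * L / S) * (2 * S * L))" using m by (simp only: l_def \<tau>_def real_sqrt_mult[symmetric]) (simp add: real_sqrt_mult[symmetric])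
    also have "(2 * L / S) * (2 * S * L) = (2 * L)\<^sup>2" using S by (simp add: power2_eq_square)
    finally show ?thesis using L by (metis abs_of_pos mult_pos_pos real_sqrt_abs zero_less_numeral)
  qed
  have l2: "l\<^sup>2 * m\<^sup>2 * S = 2 * L"
    using S L m by (simp add: l_def power_divide)
  have ind: "indep_vars (\<lambda>_. borel) (\<lambda>i x. - l * Y i x) I"
    by (rule indep_vars_compose2[OF indep]) simp
  have intY: "integrable M (Y i)" if "i \<in> I" for i
    using bd[OF that] that by (intro integrable_AE_bounded[where B = "m\<^sup>2"]) auto
  have int: "integrable M (\<lambda>x. exp (- l * Y i x))" if "i \<in> I" for i
  proof (rule integrable_AE_bounded[where B = 1])
    show "AE x in M. \<bar>exp (- l * Y i x)\<bar> \<le> 1"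
      using bd[OF that] by eventually_elim (use l in auto)
  qed (use that in auto)
  have mgf: "expectation (\<lambda>x. exp (- l * Y i x)) \<le> exp ((l\<^sup>2 * m\<^sup>2 / 2 - l) * expectation (Y i))"
    if i: "i \<in> I" for i
  proof -
    have "expectation (\<lambda>x. exp (- l * Y i x)) \<le> expectation (\<lambda>x. 1 + (l\<^sup>2 * m\<^sup>2 / 2 - l) * Y i x)"
    proof (rule integral_mono_AE)
      show "AE x in M. exp (- l * Y i x) \<le> 1 + (l\<^sup>2 * m\<^sup>2 / 2 - l) * Y i x"
        using bd[OF i]
      proof eventually_elim
        case (elim x)
        have "exp (- l * Y i x) \<le> 1 + (- l * Y i x) + (- l * Y i x)\<^sup>2 / 2"
          using elim l by (intro exp_le_quadratic_nonpos) auto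
        also have "(- l * Y i x)\<^sup>2 = l\<^sup>2 * (Y i x * Y i x)" by (simp add: power2_eq_square algebra_simps)
        also have "\<dots> \<le> l\<^sup>2 * (m\<^sup>2 * Y i x)" using elim by (intro mult_left_mono mult_right_mono) auto
        finally show ?case by (simp add: algebra_simps)
      qed
    qed (use int[OF i] intY[OF i] in auto)
    also have "\<dots> = 1 + (l\<^sup>2 * m\<^sup>2 / 2 - l) * expectation (Y i)"
      using intY[OF i] by (simp add: prob_space)
    also have "\<dots> \<le> exp ((l\<^sup>2 * m\<^sup>2 / 2 - l) * expectation (Y i))" by simp
    finally show ?thesis .
  qed
  have "\<P>(x in M. (\<Sum>i\<in>I. Y i x) \<le> S - \<tau>) = \<P>(x in M. - l * (S - \<tau>) \<le> (\<Sum>i\<in>I. - l * Y i x))"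
    using l by (simp add: sum_distrib_left[symmetric] sum_negf)
  also have "\<dots> \<le> exp ((\<Sum>i\<in>I. (l\<^sup>2 * m\<^sup>2 / 2 - l) * expectation (Y i)) - (- l * (S - \<tau>)))"
    by (intro chernoff_indep_vars fin ind int mgf)
  also have "(\<Sum>i\<in>I. (l\<^sup>2 * m\<^sup>2 / 2 - l) * expectation (Y i)) - (- l * (S - \<tau>)) = - L"
    unfolding sum_distrib_left[symmetric] S(1)[symmetric] using lt l2 by (simp add: algebra_simps)
  finally show ?thesis by (simp add: \<tau>_def)
qed

text \<open>Chernoff at the fixed parameter 1 / B, where e^x <= 1 + x + x^2 <= 1 + 2 x on [0,1].
  Accepting the factor 2 on the mean leaves a deviation that is linear in \<open>L\<close>.\<close>

lemma nonneg_sum_upper_tail: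
  fixes Y :: "'i \<Rightarrow> 'a \<Rightarrow> real"
  assumes fin: "finite I"
    and indep: "indep_vars (\<lambda>_. borel) Y I"
    and bd: "\<And>i. i \<in> I \<Longrightarrow> AE x in M. 0 \<le> Y i x \<and> Y i x \<le> B" and B: "0 < B"
  shows "\<P>(x in M. 2 * (\<Sum>i\<in>I. expectation (Y i)) + B * L \<le> (\<Sum>i\<in>I. Y i x)) \<le> exp (- L)"
proof -
  have [measurable]: "\<And>i. i \<in> I \<Longrightarrow> random_variable borel (Y i)"
    using indep by (simp add: indep_vars_def)
  have ind: "indep_vars (\<lambda>_. borel) (\<lambda>i x. Y i x / B) I"
    by (rule indep_vars_compose2[OF indep]) simp
  have intY: "integrable M (Y i)" if "i \<in> I" for i
    using bd[OF that] that by (intro integrable_AE_bounded[where B = "B"]) auto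
  have int: "integrable M (\<lambda>x. exp (Y i x / B))" if "i \<in> I" for i
  proof (rule integrable_AE_bounded[where B = "exp 1"])
    show "AE x in M. \<bar>exp (Y i x / B)\<bar> \<le> exp 1"
      using bd[OF that] by eventually_elim (use B in auto)
  qed (use that in auto)
  have mgf: "expectation (\<lambda>x. exp (Y i x / B)) \<le> exp (2 * expectation (Y i) / B)"
    if i: "i \<in> I" for i
  proof -
    have "expectation (\<lambda>x. exp (Y i x / B)) \<le> expectation (\<lambda>x. 1 + 2 / B * Y i x)"
    proof (rule integral_mono_AE)
      show "AE x in M. exp (Y i x / B) \<le> 1 + 2 / B * Y i x"
        using bd[OF i]
      proof eventually_elim
        case (elim x)
        then have *: "0 \<le> Y i x / B" "Y i x / B \<le> 1" using B by auto
        have "exp (Y i x / B) \<le> 1 + Y i x / B + (Y i x / B)\<^sup>2"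
          using * by (intro exp_bound)
        also have "(Y i x / B)\<^sup>2 \<le> Y i x / B"
          using power_decreasing[of 1 2 "Y i x / B"] * by simp
        finally show ?case by simp
      qed
    qed (use int[OF i] intY[OF i] in auto)
    also have "\<dots> = 1 + 2 * expectation (Y i) / B"
      using intY[OF i] by (simp add: prob_space)
    also have "\<dots> \<le> exp (2 * expectation (Y i) / B)" by (rule exp_ge_add_one_self)
    finally show ?thesis .
  qed
  let ?S = "\<Sum>i\<in>I. expectation (Y i)"
  have "(2 * ?S + B * L \<le> (\<Sum>i\<in>I. Y i x)) \<longleftrightarrow> 2 * ?S / B + L \<le> (\<Sum>i\<in>I. Y i x / B)" for x
  proof -
    have "2 * ?S / B + L = (2 * ?S + B * L) / B" using B by (simp add: field_simps)
    then show ?thesis using B by (simp add: sum_divide_distrib[symmetric] divide_le_cancel)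
  qed
  then have "\<P>(x in M. 2 * ?S + B * L \<le> (\<Sum>i\<in>I. Y i x)) = \<P>(x in M. 2 * ?S / B + L \<le> (\<Sum>i\<in>I. Y i x / B))"
    by simp
  also have "\<dots> \<le> exp ((\<Sum>i\<in>I. 2 * expectation (Y i) / B) - (2 * ?S / B + L))"
    by (intro chernoff_indep_vars fin ind int mgf)
  also have "\<dots> = exp (- L)"
    by (simp add: sum_divide_distrib[symmetric] sum_distrib_left[symmetric])
  finally show ?thesis .
qed

end

section \<open>The empirical Bernstein inequality\<close>

text \<open>Here \<open>a\<close> = sqrt(L / N), \<open>e\<close> is the error of the mean,
  \<open>s\<close>^2 the averaged spread about the pooled mean, \<open>q\<close> its empirical
  version, \<open>w\<close>^2 the biased sample variance, and \<open>m\<close> bounds the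
  deviations. The core is that replacing \<open>s\<close> by \<open>w\<close> costs at most 153/100
  \<open>a\<close>. A large \<open>s\<close> and an \<open>m\<close> close to 1 exclude each other
  by s^2 <= m (1 - m), and this turns the claim into a quadratic inequality in
  \<open>m\<close>.\<close>

lemma empirical_bernstein_arith:
  fixes a s m e q w :: real
  assumes a: "0 < a" and s: "0 \<le> s" "s\<^sup>2 \<le> m * (1 - m)" and m: "1 / 2 \<le> m" "m \<le> 1"
    and e: "0 \<le> e" "e \<le> sqrt 2 * s * a + a\<^sup>2 / 2"
    and q: "s\<^sup>2 - sqrt 2 * m * s * a \<le> q"
    and w: "0 \<le> w" "w\<^sup>2 = q - e\<^sup>2"
  shows "e \<le> sqrt 2 * a * w + 8 / 3 * a\<^sup>2"
proof -
  have r: "sqrt 2 \<le> 1415 / 1000" "1414 / 1000 \<le> sqrt 2"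
    by (rule real_le_lsqrt real_le_rsqrt; simp add: power2_eq_square)+
  \<comment> \<open>153/100 exceeds sqrt 2 with room to spare and keeps sqrt 2 * (153/100) + 1/2 below 8/3\<close>
  have "s \<le> w + 153 / 100 * a"
  proof (cases "s \<le> 153 / 100 * a")
    case True
    then show ?thesis using w by simp
  next
    case False
    then have s0: "0 < s" and as: "a \<le> s * (100 / 153)" using a by auto
    have "sqrt 2 * s + a / 2 \<le> 1415 / 1000 * s + s * (50 / 153)"
      using r as s0 by (intro add_mono mult_right_mono) auto
    also have "\<dots> \<le> 1742 / 1000 * s" using s0 by simp
    finally have b1: "(sqrt 2 * s + a / 2)\<^sup>2 \<le> (1742 / 1000 * s)\<^sup>2"
      using s0 a by (intro power_mono) auto
    have "a * (sqrt 2 * s + a / 2)\<^sup>2 \<le> s * (100 / 153) * (1742 / 1000 * s)\<^sup>2"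
      using as b1 a s0 by (intro mult_mono) auto
    also have "\<dots> \<le> s * (1984 / 1000 * s\<^sup>2)"
      using s0 by (simp add: power2_eq_square)
    also have "\<dots> \<le> s * (1984 / 1000 * (m * (1 - m)))"
      using s s0 by (intro mult_left_mono) auto
    also have "\<dots> \<le> s * (153 / 100 - 1415 / 1000 * m)"
    proof (intro mult_left_mono)
      \<comment> \<open>857/1000 is close to the vertex of the quadratic formed by the difference of
        the two sides.\<close>
      have "0 \<le> (m - 857 / 1000)\<^sup>2" by simp
      also have "\<dots> = m * m - 1714 / 1000 * m + 734449 / 1000000"
        by (simp add: power2_eq_square algebra_simps)
      finally show "1984 / 1000 * (m * (1 - m)) \<le> 153 / 100 - 1415 / 1000 * m"
        using m unfolding right_diff_distrib by linarith
    qed (use s0 in auto)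
    also have "\<dots> \<le> s * (153 / 100 - sqrt 2 * m)"
      using r m s0 by (intro mult_left_mono diff_left_mono mult_right_mono) auto
    finally have b2: "a * (sqrt 2 * s + a / 2)\<^sup>2 \<le> s * (153 / 100 - sqrt 2 * m)" .
    \<comment> \<open>The new right side exceeds the old one by 153/100 (s - 153/100 a), which is
      positive in this case; it is shaped to complete the square of s - 153/100 a.\<close>
    have b3: "a * (sqrt 2 * s + a / 2)\<^sup>2 \<le> s * (306 / 100 - sqrt 2 * m) - (153 / 100)\<^sup>2 * a"
      using b2 as by (simp add: power2_eq_square algebra_simps)
    have "e\<^sup>2 \<le> (sqrt 2 * s * a + a\<^sup>2 / 2)\<^sup>2" using e by (intro power_mono) auto
    also have "\<dots> = a * (a * (sqrt 2 * s + a / 2)\<^sup>2)" by (simp add: power2_eq_square algebra_simps)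
    also have "\<dots> \<le> a * (s * (306 / 100 - sqrt 2 * m) - (153 / 100)\<^sup>2 * a)"
      using b3 a by (intro mult_left_mono) auto
    finally have "(s - 153 / 100 * a)\<^sup>2 \<le> w\<^sup>2"
      using q w by (simp add: power2_eq_square algebra_simps)
    then have "s - 153 / 100 * a \<le> w" using w(1) by (rule power2_le_imp_le)
    then show ?thesis by simp
  qed
  then have "sqrt 2 * a * s \<le> sqrt 2 * a * (w + 153 / 100 * a)"
    using a by (intro mult_left_mono) auto
  moreover have "sqrt 2 * (153 / 100 * a\<^sup>2) \<le> 1415 / 1000 * (153 / 100 * a\<^sup>2)"
    using r by (intro mult_right_mono) auto
  moreover have "0 \<le> a\<^sup>2" by simp
  moreover have "sqrt 2 * a * (w + 153 / 100 * a) = sqrt 2 * a * w + sqrt 2 * (153 / 100 * a\<^sup>2)"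
    "sqrt 2 * a * s = sqrt 2 * s * a"
    by (simp_all add: power2_eq_square algebra_simps)
  ultimately show ?thesis using e(2) by linarith
qed

text \<open>Used with \<open>c\<close> the pooled mean, to express the sample variance through
  deviations about a deterministic centre, and with \<open>c\<close> = 0, to bound it by the second
  moment.\<close>

lemma sum_square_deviation:
  fixes x :: "'i \<Rightarrow> real"
  assumes "finite J" "J \<noteq> {}"
  shows "(\<Sum>i\<in>J. (x i - (\<Sum>i\<in>J. x i) / card J)\<^sup>2)
       = (\<Sum>i\<in>J. (x i - c)\<^sup>2) - card J * ((\<Sum>i\<in>J. x i) / card J - c)\<^sup>2"
proof -
  define N where "N = real (card J)"
  have N: "N > 0" using assms by (simp add: N_def card_gt_0_iff)
  define z where "z = (\<Sum>i\<in>J. x i) / N"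
  have z: "(\<Sum>i\<in>J. x i) = N * z" using N by (simp add: z_def)
  have *: "(\<Sum>i\<in>J. (x i - d)\<^sup>2) = (\<Sum>i\<in>J. (x i)\<^sup>2) - 2 * d * (N * z) + N * d\<^sup>2" for d
  proof -
    have "(\<Sum>i\<in>J. (x i - d)\<^sup>2) = (\<Sum>i\<in>J. (x i)\<^sup>2 - 2 * d * x i + d\<^sup>2)"
      by (simp add: power2_diff algebra_simps)
    also have "\<dots> = (\<Sum>i\<in>J. (x i)\<^sup>2) - 2 * d * (\<Sum>i\<in>J. x i) + N * d\<^sup>2"
      by (simp add: sum.distrib sum_subtractf sum_distrib_left N_def)
    finally show ?thesis by (simp only: z)
  qed
  then show ?thesis
    unfolding N_def[symmetric] z_def[symmetric] * by (simp add: power2_eq_square algebra_simps)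
qed

lemma measurable_bernstein_event:
  fixes X :: "'i \<Rightarrow> 'a \<Rightarrow> real"
  assumes [measurable]: "\<And>i. i \<in> J \<Longrightarrow> X i \<in> borel_measurable M"
  shows "Measurable.pred M (\<lambda>x. \<bar>(\<Sum>i\<in>J. X i x) / a - b\<bar>
      \<le> sqrt ((\<Sum>i\<in>J. (X i x - (\<Sum>i\<in>J. X i x) / a)\<^sup>2) / c) * d + e)"
  by measurable

context prob_space
begin

text \<open>The means \<open>\<mu> i\<close> may differ, so the spread is taken about their average
  \<open>mu\<close>: its expectation \<open>S\<close> is at least the sum of the variances and
  serves as proxy in Bernstein's inequality, while the sample variance is compared with
  \<open>S\<close> from below. The factor 3 counts the two tails of the mean and the lower tail of
  the spread.\<close>

lemma empirical_bernstein_unit: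
  fixes X :: "'i \<Rightarrow> 'a \<Rightarrow> real"
  assumes fin: "finite J" and N: "card J = N" "2 \<le> N"
    and indep: "indep_vars (\<lambda>_. borel) X J"
    and bd: "\<And>i. i \<in> J \<Longrightarrow> AE x in M. 0 \<le> X i x \<and> X i x \<le> 1" and L: "0 < L"
  shows "\<P>(x in M. \<not> \<bar>(\<Sum>i\<in>J. X i x) / N - (\<Sum>i\<in>J. expectation (X i)) / N\<bar>
      \<le> sqrt ((\<Sum>i\<in>J. (X i x - (\<Sum>i\<in>J. X i x) / N)\<^sup>2) / (real N - 1)) * sqrt (2 * L / N)
         + 8 / 3 * L / (real N - 1)) \<le> 3 * exp (- L)"
proof -
  have rv[measurable]: "\<And>i. i \<in> J \<Longrightarrow> random_variable borel (X i)"
    using indep by (simp add: indep_vars_def)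
  have Npos: "0 < real N" "1 < real N" and ne: "J \<noteq> {}" using N by auto
  have int: "integrable M (X i)" "integrable M (\<lambda>x. (X i x)\<^sup>2)" if "i \<in> J" for i
    using bd[OF that] that by (auto intro!: integrable_AE_bounded[where B = 1] simp: abs_square_le_1)
  define \<mu> where "\<mu> i = expectation (X i)" for i
  define mu where "mu = (\<Sum>i\<in>J. \<mu> i) / N"
  have mu_i: "0 \<le> \<mu> i" "\<mu> i \<le> 1" if "i \<in> J" for i
  proof -
    show "0 \<le> \<mu> i" unfolding \<mu>_def using bd[OF that] by (intro integral_nonneg_AE) auto
    have "\<mu> i \<le> expectation (\<lambda>_. 1)"
      unfolding \<mu>_def using bd[OF that] int[OF that] by (intro integral_mono_AE) auto
    then show "\<mu> i \<le> 1" by (simp add: prob_space)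
  qed
  have smu: "(\<Sum>i\<in>J. \<mu> i) = N * mu" using Npos by (simp add: mu_def)
  have mu: "0 \<le> mu" "mu \<le> 1"
    using sum_nonneg[of J \<mu>] sum_bounded_above[of J \<mu> 1] mu_i Npos N
    by (auto simp: mu_def divide_le_eq)
  \<comment> \<open>The largest |x - mu| for x in [0,1]. Replacing mu by m keeps the variance
    ceiling mu (1 - mu).\<close>
  define m where "m = max mu (1 - mu)"
  have m: "1 / 2 \<le> m" "m \<le> 1" and mm: "m * (1 - m) = mu * (1 - mu)"
    using mu by (auto simp: m_def max_def)
  define Y where "Y = (\<lambda>i x. (X i x - mu)\<^sup>2)"
  have Ybd: "AE x in M. 0 \<le> Y i x \<and> Y i x \<le> m\<^sup>2" if "i \<in> J" for i
    using bd[OF that]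
  proof eventually_elim
    case (elim x)
    then have "\<bar>X i x - mu\<bar> \<le> m" using mu by (auto simp: m_def)
    then have "(X i x - mu)\<^sup>2 \<le> m\<^sup>2" using m by (intro abs_le_square_iff[THEN iffD1]) auto
    then show ?case by (simp add: Y_def)
  qed
  have [measurable]: "\<And>i. i \<in> J \<Longrightarrow> random_variable borel (Y i)" by (simp add: Y_def)
  have intY: "integrable M (Y i)" if "i \<in> J" for i
    using Ybd[OF that] that by (intro integrable_AE_bounded[where B = "m\<^sup>2"]) auto
  have EY: "expectation (Y i) = expectation (\<lambda>x. (X i x)\<^sup>2) - 2 * mu * \<mu> i + mu\<^sup>2" if "i \<in> J" for i
    using int[OF that] by (simp add: Y_def \<mu>_def power2_diff prob_space algebra_simps)
  define S where "S = (\<Sum>i\<in>J. expectation (Y i))"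
  have S0: "0 \<le> S" unfolding S_def Y_def by (intro sum_nonneg integral_nonneg_AE) auto
  have Sm: "S \<le> N * (m * (1 - m))"
  proof -
    have "S \<le> (\<Sum>i\<in>J. \<mu> i - 2 * mu * \<mu> i + mu\<^sup>2)"
      unfolding S_def
    proof (rule sum_mono)
      fix i assume i: "i \<in> J"
      have "expectation (\<lambda>x. (X i x)\<^sup>2) \<le> \<mu> i"
        unfolding \<mu>_def
      proof (rule integral_mono_AE)
        show "AE x in M. (X i x)\<^sup>2 \<le> X i x"
          using bd[OF i] by eventually_elim (simp add: power2_eq_square mult_left_le)
      qed (use int i in auto)
      then show "expectation (Y i) \<le> \<mu> i - 2 * mu * \<mu> i + mu\<^sup>2" using EY[OF i] by simp
    qed
    also have "\<dots> = N * mu - 2 * mu * (N * mu) + N * mu\<^sup>2"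
      using N by (simp add: sum.distrib sum_subtractf sum_distrib_left[symmetric] smu)
    also have "\<dots> = N * (mu * (1 - mu))" by (simp add: power2_eq_square algebra_simps)
    finally show ?thesis by (simp add: mm)
  qed
  have V: "(\<Sum>i\<in>J. expectation (\<lambda>x. (X i x - \<mu> i)\<^sup>2)) \<le> S"
    unfolding S_def
  proof (rule sum_mono)
    fix i assume i: "i \<in> J"
    have "expectation (\<lambda>x. (X i x - \<mu> i)\<^sup>2) = expectation (\<lambda>x. (X i x)\<^sup>2) - (\<mu> i)\<^sup>2"
      unfolding \<mu>_def using int[OF i] by (rule variance_eq)
    also have "\<dots> \<le> expectation (Y i)"
      using EY[OF i] zero_le_power2[of "\<mu> i - mu"] by (simp add: power2_diff algebra_simps)
    finally show "expectation (\<lambda>x. (X i x - \<mu> i)\<^sup>2) \<le> expectation (Y i)" .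
  qed
  define bad where "bad x \<longleftrightarrow> \<not> \<bar>(\<Sum>i\<in>J. X i x) / N - (\<Sum>i\<in>J. expectation (X i)) / N\<bar>
      \<le> sqrt ((\<Sum>i\<in>J. (X i x - (\<Sum>i\<in>J. X i x) / N)\<^sup>2) / (real N - 1)) * sqrt (2 * L / N)
         + 8 / 3 * L / (real N - 1)" for x
  have bad_sets: "{x \<in> space M. bad x} \<in> events" unfolding bad_def pred_def[symmetric]
    by (intro pred_intros_logic measurable_bernstein_event rv)
  have dev: "(\<Sum>i\<in>J. X i x) / N - (\<Sum>i\<in>J. expectation (X i)) / N = (\<Sum>i\<in>J. X i x - \<mu> i) / N" for x
    by (simp add: \<mu>_def sum_subtractf diff_divide_distrib)
  have "\<P>(x in M. bad x) \<le> 3 * exp (- L)"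
  \<comment> \<open>The tail lemmas take a positive proxy. For \<open>S\<close> = 0 every
    \<open>X i\<close> equals \<open>mu\<close> almost surely, and the radius is
    nonnegative.\<close>
  proof (cases "S = 0")
    case True
    have z: "AE x in M. X i x = mu" if "i \<in> J" for i
    proof -
      have "expectation (Y i) = 0"
        using True sum_nonneg_eq_0_iff[OF fin, of "\<lambda>i. expectation (Y i)"] that
        by (auto simp: S_def Y_def intro!: integral_nonneg_AE)
      then have "AE x in M. Y i x = 0"
        using intY[OF that] by (subst integral_nonneg_eq_0_iff_AE[symmetric]) (auto simp: Y_def)
      then show ?thesis by (simp add: Y_def)
    qed
    have "AE x in M. \<forall>i\<in>J. X i x = mu" using z fin by (simp add: AE_finite_allI)
    then have "AE x in M. \<not> bad x"
    proof eventually_elim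
      case (elim x)
      then have "(\<Sum>i\<in>J. X i x) / N - (\<Sum>i\<in>J. expectation (X i)) / N = 0"
        unfolding dev by (simp add: sum_subtractf smu N)
      moreover have "0 \<le> sqrt ((\<Sum>i\<in>J. (X i x - (\<Sum>i\<in>J. X i x) / N)\<^sup>2) / (real N - 1)) * sqrt (2 * L / N)
         + 8 / 3 * L / (real N - 1)"
        using Npos L by (intro add_nonneg_nonneg mult_nonneg_nonneg divide_nonneg_nonneg
            real_sqrt_ge_zero sum_nonneg) auto
      ultimately show ?case unfolding bad_def by (simp only: abs_zero simp_thms)
    qed
    then have "\<P>(x in M. bad x) = 0" using prob_Collect_eq_0[OF bad_sets] by blast
    then show ?thesis by simp
  next
    case False
    with S0 have S: "0 < S" by simp
    let ?b = "sqrt (2 * S * L) + L / 2"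
    define E1 where "E1 x \<longleftrightarrow> ?b \<le> (\<Sum>i\<in>J. X i x - \<mu> i)" for x
    define E2 where "E2 x \<longleftrightarrow> ?b \<le> (\<Sum>i\<in>J. \<mu> i - X i x)" for x
    define E3 where "E3 x \<longleftrightarrow> (\<Sum>i\<in>J. Y i x) \<le> S - m * sqrt (2 * S * L)" for x
    have E_sets: "{x \<in> space M. E1 x} \<in> events" "{x \<in> space M. E2 x} \<in> events"
        "{x \<in> space M. E3 x} \<in> events"
      unfolding E1_def E2_def E3_def by measurable
    have cbd: "AE x in M. \<bar>X i x - \<mu> i\<bar> \<le> 1" if "i \<in> J" for i
      using bd[OF that] by eventually_elim (use mu_i[OF that] in auto)
    have p1: "\<P>(x in M. E1 x) \<le> exp (- L)"
      unfolding E1_def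
    proof (rule bernstein_upper_tail[OF fin])
      show "indep_vars (\<lambda>_. borel) (\<lambda>i x. X i x - \<mu> i) J"
        by (rule indep_vars_compose2[OF indep]) simp
    qed (use cbd V S L int in \<open>auto simp: \<mu>_def prob_space\<close>)
    have p2: "\<P>(x in M. E2 x) \<le> exp (- L)"
      unfolding E2_def
    proof (rule bernstein_upper_tail[OF fin])
      show "indep_vars (\<lambda>_. borel) (\<lambda>i x. \<mu> i - X i x) J"
        by (rule indep_vars_compose2[OF indep]) simp
    qed (use cbd V S L int in \<open>auto simp: \<mu>_def prob_space abs_minus_commute power2_commute\<close>)
    have p3: "\<P>(x in M. E3 x) \<le> exp (- L)"
      unfolding E3_def
    proof (rule nonneg_sum_lower_tail[OF fin])
      show "indep_vars (\<lambda>_. borel) Y J"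
        unfolding Y_def by (rule indep_vars_compose2[OF indep]) simp
    qed (use Ybd S L m in \<open>auto simp: S_def\<close>)
    have imp: "E1 x \<or> E2 x \<or> E3 x" if "bad x" for x
    proof (rule ccontr)
      assume neg: "\<not> (E1 x \<or> E2 x \<or> E3 x)"
      define a where "a = sqrt (L / N)"
      define s where "s = sqrt (S / N)"
      define e where "e = \<bar>(\<Sum>i\<in>J. X i x - \<mu> i) / N\<bar>"
      define q where "q = (\<Sum>i\<in>J. Y i x) / N"
      define w where "w = sqrt ((\<Sum>i\<in>J. (X i x - (\<Sum>i\<in>J. X i x) / N)\<^sup>2) / N)"
      have a2: "a\<^sup>2 = L / N" "0 < a" and s2: "s\<^sup>2 = S / N" "0 \<le> s"
        using L Npos S by (auto simp: a_def s_def)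
      have sq: "sqrt (2 * S * L) = N * (sqrt 2 * s * a)"
      proof -
        have "s * a = sqrt S * sqrt L / N"
          by (simp add: a_def s_def real_sqrt_divide)
        then have "N * (s * a) = sqrt S * sqrt L" using Npos by simp
        then show ?thesis by (simp add: real_sqrt_mult algebra_simps)
      qed
      have "e \<le> sqrt 2 * s * a + a\<^sup>2 / 2"
      proof -
        have "\<bar>\<Sum>i\<in>J. X i x - \<mu> i\<bar> \<le> ?b"
          using neg by (auto simp: E1_def E2_def sum_subtractf)
        then have "e \<le> ?b / N" using Npos by (simp add: e_def divide_right_mono)
        also have "\<dots> = sqrt 2 * s * a + a\<^sup>2 / 2" unfolding sq a2(1) using Npos by (simp add: field_simps)
        finally show ?thesis .
      qed
      moreover have "s\<^sup>2 - sqrt 2 * m * s * a \<le> q"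
      proof -
        have "(S - m * sqrt (2 * S * L)) / N \<le> q"
          using neg Npos by (simp add: q_def E3_def divide_right_mono)
        then show ?thesis unfolding sq s2(1) using Npos by (simp add: diff_divide_distrib algebra_simps)
      qed
      moreover have "w\<^sup>2 = q - e\<^sup>2"
      proof -
        have "w\<^sup>2 = (\<Sum>i\<in>J. (X i x - (\<Sum>i\<in>J. X i x) / N)\<^sup>2) / N"
          using Npos by (simp add: w_def sum_nonneg)
        also have "\<dots> = q - ((\<Sum>i\<in>J. X i x) / N - mu)\<^sup>2"
          using sum_square_deviation[OF fin ne, of "\<lambda>i. X i x" mu] Npos N
          by (simp add: q_def Y_def diff_divide_distrib)
        also have "(\<Sum>i\<in>J. X i x) / N - mu = (\<Sum>i\<in>J. X i x - \<mu> i) / N"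
          by (simp add: mu_def sum_subtractf diff_divide_distrib)
        finally show ?thesis by (simp add: e_def power_divide)
      qed
      moreover have "s\<^sup>2 \<le> m * (1 - m)"
        unfolding s2(1) using Sm Npos by (simp add: divide_le_eq mult.commute)
      moreover have "0 \<le> e" "0 \<le> w"
        using Npos by (auto simp: e_def w_def intro!: divide_nonneg_nonneg sum_nonneg)
      ultimately have "e \<le> sqrt 2 * a * w + 8 / 3 * a\<^sup>2"
        using a2(2) s2(2) m by (intro empirical_bernstein_arith[of a s m e q w])
      also have "sqrt 2 * a * w \<le> sqrt ((\<Sum>i\<in>J. (X i x - (\<Sum>i\<in>J. X i x) / N)\<^sup>2) / (real N - 1)) * sqrt (2 * L / N)"
      proof -
        \<comment> \<open>Passing from the divisor N to N - 1 only widens the radius.\<close>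
        have "w \<le> sqrt ((\<Sum>i\<in>J. (X i x - (\<Sum>i\<in>J. X i x) / N)\<^sup>2) / (real N - 1))"
          unfolding w_def using Npos by (intro real_sqrt_le_mono divide_left_mono sum_nonneg) auto
        then have "(sqrt 2 * a) * w \<le> (sqrt 2 * a) * sqrt ((\<Sum>i\<in>J. (X i x - (\<Sum>i\<in>J. X i x) / N)\<^sup>2) / (real N - 1))"
          using a2 by (intro mult_left_mono) auto
        moreover have "sqrt 2 * a = sqrt (2 * L / N)" by (simp add: a_def real_sqrt_mult real_sqrt_divide)
        ultimately show ?thesis by (simp only: mult.commute)
      qed
      also have "8 / 3 * a\<^sup>2 \<le> 8 / 3 * L / (real N - 1)"
        using L Npos by (simp add: a2 frac_le)
      finally show False using that by (simp add: bad_def dev e_def)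
    qed
    let ?E1 = "{x \<in> space M. E1 x}" and ?E2 = "{x \<in> space M. E2 x}" and ?E3 = "{x \<in> space M. E3 x}"
    have "\<P>(x in M. bad x) \<le> prob (?E1 \<union> (?E2 \<union> ?E3))"
      using E_sets imp by (intro finite_measure_mono) auto
    also have "\<dots> \<le> prob ?E1 + prob (?E2 \<union> ?E3)"
      using E_sets by (intro measure_Un_le) auto
    also have "prob (?E2 \<union> ?E3) \<le> prob ?E2 + prob ?E3"
      using E_sets by (intro measure_Un_le) auto
    finally show ?thesis using p1 p2 p3 by linarith
  qed
  then show ?thesis unfolding bad_def .
qed

text \<open>Affine rescaling of [-B, B] to [0,1]; undoing it multiplies by 2 B, which turns 8/3 into
  16/3 B. For B = 4 M^2 this is the 64 M^2 / 3 of \<open>psi_hat\<close>.\<close>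

lemma empirical_bernstein:
  fixes U :: "'i \<Rightarrow> 'a \<Rightarrow> real"
  assumes fin: "finite J" and N: "card J = N" "2 \<le> N"
    and indep: "indep_vars (\<lambda>_. borel) U J"
    and bd: "\<And>i. i \<in> J \<Longrightarrow> AE x in M. \<bar>U i x\<bar> \<le> B" and B: "0 < B" and L: "0 < L"
  shows "\<P>(x in M. \<not> \<bar>(\<Sum>i\<in>J. U i x) / N - (\<Sum>i\<in>J. expectation (U i)) / N\<bar>
      \<le> sqrt ((\<Sum>i\<in>J. (U i x - (\<Sum>i\<in>J. U i x) / N)\<^sup>2) / (real N - 1)) * sqrt (2 * L / N)
         + 16 / 3 * B * L / (real N - 1)) \<le> 3 * exp (- L)"
proof -
  have rv[measurable]: "\<And>i. i \<in> J \<Longrightarrow> random_variable borel (U i)"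
    using indep by (simp add: indep_vars_def)
  have Npos: "0 < real N" "1 < real N" using N by auto
  have int: "integrable M (U i)" if "i \<in> J" for i
    using bd[OF that] that by (auto intro!: integrable_AE_bounded[where B = B])
  define X where "X = (\<lambda>i x. U i x / (2 * B) + 1 / 2)"
  have UX: "U i x = 2 * B * X i x - B" for i x using B by (simp add: X_def field_simps)
  have EX: "expectation (X i) = expectation (U i) / (2 * B) + 1 / 2" if "i \<in> J" for i
    using int[OF that] by (simp add: X_def prob_space)
  have sU: "(\<Sum>i\<in>J. U i x) / N = 2 * B * ((\<Sum>i\<in>J. X i x) / N) - B" for x
    using Npos N by (simp add: UX sum_subtractf sum_distrib_left[symmetric] diff_divide_distrib)
  have sE: "(\<Sum>i\<in>J. expectation (U i)) / N = 2 * B * ((\<Sum>i\<in>J. expectation (X i)) / N) - B"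
  proof -
    have "(\<Sum>i\<in>J. expectation (U i)) = (\<Sum>i\<in>J. 2 * B * expectation (X i) - B)"
      using B by (intro sum.cong) (auto simp: EX field_simps)
    then show ?thesis
      using Npos N by (simp add: sum_subtractf sum_distrib_left[symmetric] diff_divide_distrib)
  qed
  have ind: "indep_vars (\<lambda>_. borel) X J"
    unfolding X_def by (rule indep_vars_compose2[OF indep]) simp
  have bdX: "AE x in M. 0 \<le> X i x \<and> X i x \<le> 1" if "i \<in> J" for i
    using bd[OF that] by eventually_elim (use B in \<open>auto simp: X_def field_simps\<close>)
  have *: "(\<bar>(\<Sum>i\<in>J. U i x) / N - (\<Sum>i\<in>J. expectation (U i)) / N\<bar>
      \<le> sqrt ((\<Sum>i\<in>J. (U i x - (\<Sum>i\<in>J. U i x) / N)\<^sup>2) / (real N - 1)) * sqrt (2 * L / N)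
         + 16 / 3 * B * L / (real N - 1)) \<longleftrightarrow> (\<bar>(\<Sum>i\<in>J. X i x) / N - (\<Sum>i\<in>J. expectation (X i)) / N\<bar>
      \<le> sqrt ((\<Sum>i\<in>J. (X i x - (\<Sum>i\<in>J. X i x) / N)\<^sup>2) / (real N - 1)) * sqrt (2 * L / N)
         + 8 / 3 * L / (real N - 1))" (is "?l \<longleftrightarrow> ?r") for x
  proof -
    define q where "q = (\<Sum>i\<in>J. (X i x - (\<Sum>i\<in>J. X i x) / N)\<^sup>2) / (real N - 1)"
    define c where "c = (\<Sum>i\<in>J. X i x) / N"
    have "(\<Sum>i\<in>J. (U i x - (\<Sum>i\<in>J. U i x) / N)\<^sup>2) = (\<Sum>i\<in>J. (2 * B)\<^sup>2 * (X i x - c)\<^sup>2)"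
      unfolding sU c_def[symmetric]
      by (intro sum.cong refl) (simp add: UX power2_eq_square algebra_simps)
    then have "sqrt ((\<Sum>i\<in>J. (U i x - (\<Sum>i\<in>J. U i x) / N)\<^sup>2) / (real N - 1)) = sqrt ((2 * B)\<^sup>2 * q)"
      by (simp add: q_def c_def sum_distrib_left)
    also have "\<dots> = 2 * B * sqrt q" using B by (simp only: real_sqrt_mult real_sqrt_abs abs_mult)
    finally have v: "sqrt ((\<Sum>i\<in>J. (U i x - (\<Sum>i\<in>J. U i x) / N)\<^sup>2) / (real N - 1)) = 2 * B * sqrt q" .
    have lhs: "\<bar>(\<Sum>i\<in>J. U i x) / N - (\<Sum>i\<in>J. expectation (U i)) / N\<bar>
        = 2 * B * \<bar>(\<Sum>i\<in>J. X i x) / N - (\<Sum>i\<in>J. expectation (X i)) / N\<bar>"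
    proof -
      have "\<bar>2 * B * a - B - (2 * B * b - B)\<bar> = 2 * B * \<bar>a - b\<bar>" for a b
        using B abs_mult[of "2 * B" "a - b"] by (simp add: right_diff_distrib)
      then show ?thesis unfolding sU sE .
    qed
    have rhs: "2 * B * sqrt q * sqrt (2 * L / N) + 16 / 3 * B * L / (real N - 1)
       = 2 * B * (sqrt q * sqrt (2 * L / N) + 8 / 3 * L / (real N - 1))"
      by (simp add: algebra_simps)
    show ?thesis
      unfolding v lhs rhs q_def[symmetric] using B by simp
  qed
  show ?thesis
    using empirical_bernstein_unit[OF fin N ind bdX L] by (simp only: *)
qed

end

section \<open>Total variation and integrals of bounded functions\<close>

lemma measure_diff_le_tv_dist:
  assumes "prob_space P" "prob_space Q" "A \<in> sets P"
  shows "\<bar>measure P A - measure Q A\<bar> \<le> tv_dist P Q"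
  unfolding tv_dist_def
proof (rule cSUP_upper[OF assms(3)])
  interpret P: prob_space P by fact
  interpret Q: prob_space Q by fact
  show "bdd_above ((\<lambda>A. \<bar>measure P A - measure Q A\<bar>) ` sets P)"
  proof (rule bdd_aboveI2[where M = 1])
    fix A
    show "\<bar>measure P A - measure Q A\<bar> \<le> 1"
      using P.prob_le_1[of A] Q.prob_le_1[of A] measure_nonneg[of P A] measure_nonneg[of Q A] by linarith
  qed
qed

lemma tv_dist_nonneg:
  assumes "prob_space P" "prob_space Q"
  shows "0 \<le> tv_dist P Q"
  using measure_diff_le_tv_dist[OF assms, of "{}"] by simp

text \<open>Discrete layer-cake formula: up to 1 / k, a function with values in [0,1] is the average
  of the indicators of \<open>k\<close> superlevel sets, and total variation controls each of these
  sets.\<close>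

lemma staircase_approx:
  fixes y :: real
  assumes "0 \<le> y" "y \<le> 1" and k: "0 < k"
  defines "s \<equiv> (\<Sum>i\<in>{1..k}. if real i \<le> k * y then 1 else 0) / real k"
  shows "s \<le> y" "y \<le> s + 1 / real k"
proof -
  define c where "c = nat \<lfloor>k * y\<rfloor>"
  have c: "real c \<le> k * y" "k * y < real c + 1"
    using assms by (auto simp: c_def)
  have "real c \<le> real k" using c(1) mult_left_le[of y "real k"] assms by linarith
  then have ck: "c \<le> k" by simp
  have "{i \<in> {1..k}. real i \<le> k * y} = {1..c}"
  proof -
    have *: "real i \<le> k * y \<longleftrightarrow> i \<le> c" for i
    proof (cases "i \<le> c")
      case True
      then have "real i \<le> real c" by simp
      then show ?thesis using c True by linarith
    next
      case False
      then have "real c + 1 \<le> real i" by linarith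
      then show ?thesis using c False by linarith
    qed
    show ?thesis unfolding * using ck by auto
  qed
  then have s: "s = real c / k"
    by (simp add: s_def sum.If_cases Int_def)
  show "s \<le> y" using c k unfolding s by (simp add: divide_le_eq mult.commute)
  show "y \<le> s + 1 / real k"
    using c k unfolding s by (simp add: add_divide_distrib[symmetric] le_divide_eq mult.commute)
qed

lemma integral_diff_le_tv_dist_unit:
  fixes g :: "'a \<Rightarrow> real"
  assumes P: "prob_space P" and Q: "prob_space Q" and sets: "sets P = sets Q"
    and [measurable]: "g \<in> borel_measurable P" and g: "\<And>z. 0 \<le> g z" "\<And>z. g z \<le> 1"
  shows "(\<integral>z. g z \<partial>P) - (\<integral>z. g z \<partial>Q) \<le> tv_dist P Q"
proof (rule field_le_epsilon)
  fix e :: real assume "0 < e"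
  interpret P: prob_space P by fact
  interpret Q: prob_space Q by fact
  have gQ[measurable]: "g \<in> borel_measurable Q"
    using assms(4) measurable_cong_sets[OF sets refl] by blast
  obtain k :: nat where k: "0 < k" "1 / real k < e"
    using \<open>0 < e\<close> by (metis nat_approx_posE of_nat_Suc zero_less_Suc)
  define A where "A i = {z \<in> space P. real i \<le> k * g z}" for i :: nat
  have A[measurable]: "A i \<in> sets P" "A i \<in> sets Q" for i
    unfolding A_def sets[symmetric] by measurable
  define s where "s z = (\<Sum>i\<in>{1..k}. if real i \<le> k * g z then 1 else 0) / real k" for z
  have s: "s z \<le> g z" "g z \<le> s z + 1 / k" for z
    using staircase_approx[of "g z" k] g[of z] k by (auto simp: s_def)
  have s_ind: "s z = (\<Sum>i\<in>{1..k}. indicator (A i) z) / real k" if "z \<in> space P" for z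
    unfolding s_def by (intro arg_cong2[of _ _ _ _ "(/)"] sum.cong refl) (simp add: A_def that)
  have sp: "space P = space Q" using sets by (rule sets_eq_imp_space_eq)
  have iP: "integrable P s" "(\<integral>z. s z \<partial>P) = (\<Sum>i\<in>{1..k}. measure P (A i)) / k"
    using Bochner_Integration.integrable_cong[OF refl s_ind, of P]
      Bochner_Integration.integral_cong[OF refl s_ind, of P]
    by (auto simp: P.emeasure_eq_measure)
  have iQ: "integrable Q s" "(\<integral>z. s z \<partial>Q) = (\<Sum>i\<in>{1..k}. measure Q (A i)) / k"
    using Bochner_Integration.integrable_cong[OF refl s_ind, of Q]
      Bochner_Integration.integral_cong[OF refl s_ind, of Q] sp
    by (auto simp: Q.emeasure_eq_measure)
  have gint: "integrable P g" "integrable Q g"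
    using g by (auto intro!: P.integrable_const_bound[where B = 1] Q.integrable_const_bound[where B = 1] simp: abs_le_iff intro: order_trans[of _ 0])
  have "(\<integral>z. g z \<partial>P) \<le> (\<integral>z. s z + 1 / k \<partial>P)"
    using s gint iP by (intro integral_mono) auto
  also have "\<dots> = (\<Sum>i\<in>{1..k}. measure P (A i)) / k + 1 / k"
    using iP by (simp add: P.prob_space)
  finally have 1: "(\<integral>z. g z \<partial>P) \<le> (\<Sum>i\<in>{1..k}. measure P (A i)) / k + 1 / k" .
  have 2: "(\<Sum>i\<in>{1..k}. measure Q (A i)) / k \<le> (\<integral>z. g z \<partial>Q)"
    unfolding iQ(2)[symmetric] using s gint iQ by (intro integral_mono) auto
  have "(\<Sum>i\<in>{1..k}. measure P (A i) - measure Q (A i)) \<le> real (card {1..k}) * tv_dist P Q"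
    by (rule sum_bounded_above) (use measure_diff_le_tv_dist[OF P Q A(1)] abs_le_D1 in blast)
  then have "(\<Sum>i\<in>{1..k}. measure P (A i)) / k - (\<Sum>i\<in>{1..k}. measure Q (A i)) / k \<le> tv_dist P Q"
    using k by (simp add: sum_subtractf diff_divide_distrib[symmetric] divide_le_eq mult.commute)
  then show "(\<integral>z. g z \<partial>P) - (\<integral>z. g z \<partial>Q) \<le> tv_dist P Q + e"
    using 1 2 k by linarith
qed

text \<open>The bound on g holds almost surely only, so g is truncated before comparing.\<close>

lemma integral_diff_le_tv_dist:
  fixes g :: "'a \<Rightarrow> real"
  assumes P: "prob_space P" and Q: "prob_space Q" and sets: "sets P = sets Q"
    and [measurable]: "g \<in> borel_measurable P"
    and bP: "AE z in P. \<bar>g z\<bar> \<le> B" and bQ: "AE z in Q. \<bar>g z\<bar> \<le> B" and B: "0 < B"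
  shows "(\<integral>z. g z \<partial>P) - (\<integral>z. g z \<partial>Q) \<le> 2 * B * tv_dist P Q"
proof -
  interpret P: prob_space P by fact
  interpret Q: prob_space Q by fact
  have gQ[measurable]: "g \<in> borel_measurable Q"
    using assms(4) measurable_cong_sets[OF sets refl] by blast
  define h where "h z = max 0 (min 1 (g z / (2 * B) + 1 / 2))" for z
  have [measurable]: "h \<in> borel_measurable P" "h \<in> borel_measurable Q"
    unfolding h_def by measurable
  have gh: "g z = 2 * B * h z - B" if "\<bar>g z\<bar> \<le> B" for z
    using that B by (auto simp: h_def max_def min_def field_simps)
  have ih: "integrable P h" "integrable Q h"
    by (auto intro!: P.integrable_const_bound[where B = 1] Q.integrable_const_bound[where B = 1] simp: h_def)
  have "(\<integral>z. g z \<partial>P) = (\<integral>z. 2 * B * h z - B \<partial>P)"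
    using AE_mp[OF bP AE_I2[OF impI[OF gh]]] by (intro integral_cong_AE) auto
  moreover have "(\<integral>z. g z \<partial>Q) = (\<integral>z. 2 * B * h z - B \<partial>Q)"
    using AE_mp[OF bQ AE_I2[OF impI[OF gh]]] by (intro integral_cong_AE) auto
  ultimately have "(\<integral>z. g z \<partial>P) - (\<integral>z. g z \<partial>Q) = 2 * B * ((\<integral>z. h z \<partial>P) - (\<integral>z. h z \<partial>Q))"
    using ih by (simp add: P.prob_space Q.prob_space algebra_simps)
  also have "\<dots> \<le> 2 * B * tv_dist P Q"
    using B by (intro mult_left_mono integral_diff_le_tv_dist_unit P Q sets) (auto simp: h_def)
  finally show ?thesis .
qed

section \<open>Excess risk as a squared distance to the regression function\<close>

text \<open>Pythagoras: the residual of the response is orthogonal to bounded functions of the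
  covariate, so the cross term vanishes. The regression function inherits the bound \<open>K\<close>
  of the response, which makes all the products integrable.\<close>

lemma excess_risk_eq_sq_dist:
  assumes P: "prob_space P" and sets: "sets P = sets (borel :: (covar \<times> real) measure)"
    and f: "f \<in> borel_measurable borel"
    and bf: "AE z in P. \<bar>f (fst z)\<bar> \<le> K" and bY: "AE z in P. \<bar>snd z\<bar> \<le> K"
  shows "excess_risk P f
      = (\<integral>z. (f (fst z) - real_cond_exp P (vimage_algebra (space P) fst borel) snd z)\<^sup>2 \<partial>P)"
    and "AE z in P. \<bar>real_cond_exp P (vimage_algebra (space P) fst borel) snd z\<bar> \<le> K"
proof -
  interpret P: prob_space P by fact
  let ?F = "vimage_algebra (space P) fst (borel :: covar measure)"
  have fstm[measurable]: "fst \<in> P \<rightarrow>\<^sub>M (borel :: covar measure)"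
    and sndm[measurable]: "snd \<in> borel_measurable P"
    unfolding measurable_cong_sets[OF sets refl]
    by (intro borel_measurable_continuous_onI continuous_on_fst continuous_on_snd continuous_on_id)+
  have sub: "subalgebra P ?F"
    unfolding subalgebra_def using measurable_iff_sets[THEN iffD1, OF fstm] by simp
  interpret F: finite_measure_subalgebra P ?F
    by unfold_locales (rule sub)
  define c where "c = real_cond_exp P ?F snd"
  have isnd: "integrable P snd"
    using bY by (intro P.integrable_const_bound[where B = K]) auto
  have cF[measurable]: "c \<in> borel_measurable ?F" by (simp add: c_def)
  have cP[measurable]: "c \<in> borel_measurable P" by (simp add: c_def)
  have "AE z in P. c z \<ge> - K" "AE z in P. c z \<le> K"
    unfolding c_def using bY isnd by (intro F.real_cond_exp_ge_c F.real_cond_exp_le_c; auto)+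
  then show bc: "AE z in P. \<bar>c z\<bar> \<le> K" unfolding c_def by eventually_elim auto
  have fP[measurable]: "(\<lambda>z. f (fst z)) \<in> borel_measurable P"
    using measurable_compose[OF fstm f] .
  have fF[measurable]: "(\<lambda>z. f (fst z)) \<in> borel_measurable ?F"
    by (rule measurable_compose[OF measurable_vimage_algebra1 f]) auto
  have bd: "AE z in P. \<bar>(f (fst z) - c z)\<bar> \<le> 2 * K" "AE z in P. \<bar>(c z - snd z)\<bar> \<le> 2 * K"
    using bf bc bY by (eventually_elim, linarith)+
  have bprod: "integrable P (\<lambda>z. p z * q z)"
    if "p \<in> borel_measurable P" "q \<in> borel_measurable P"
      "AE z in P. \<bar>p z\<bar> \<le> B" "AE z in P. \<bar>q z\<bar> \<le> B'" for p q :: "covar \<times> real \<Rightarrow> real" and B B'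
  proof (rule P.integrable_const_bound[where B = "B * B'"])
    show "AE z in P. norm (p z * q z) \<le> B * B'"
      using that(3,4) by eventually_elim (auto simp: abs_mult intro!: mult_mono order_trans[OF abs_ge_zero])
  qed (use that in auto)
  have i1: "integrable P (\<lambda>z. (f (fst z) - c z) * snd z)"
    and i2: "integrable P (\<lambda>z. (f (fst z) - c z) * c z)"
    and i3: "integrable P (\<lambda>z. (f (fst z) - c z) * (f (fst z) - c z))"
    and i4: "integrable P (\<lambda>z. (c z - snd z) * (c z - snd z))"
    by (rule bprod; (rule bd bY bc | measurable))+
  have cross: "(\<integral>z. (f (fst z) - c z) * c z \<partial>P) = (\<integral>z. (f (fst z) - c z) * snd z \<partial>P)"
    using F.real_cond_exp_intg(2)[OF i1] unfolding c_def[symmetric] by simp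
  have "risk P f = (\<integral>z. (f (fst z) - c z) * (f (fst z) - c z) + (c z - snd z) * (c z - snd z)
      + 2 * ((f (fst z) - c z) * c z - (f (fst z) - c z) * snd z) \<partial>P)"
    unfolding risk_def by (intro Bochner_Integration.integral_cong) (auto simp: power2_eq_square algebra_simps)
  also have "\<dots> = (\<integral>z. (f (fst z) - c z) * (f (fst z) - c z) \<partial>P) + (\<integral>z. (c z - snd z) * (c z - snd z) \<partial>P)"
    using i1 i2 i3 i4 cross by simp
  finally show "excess_risk P f
      = (\<integral>z. (f (fst z) - real_cond_exp P (vimage_algebra (space P) fst borel) snd z)\<^sup>2 \<partial>P)"
    by (simp add: excess_risk_def bayes_risk_def c_def power2_eq_square)
qed

section \<open>The Bernstein condition for the squared loss\<close>

definition sq_loss_diff :: "(covar \<Rightarrow> real) \<Rightarrow> (covar \<Rightarrow> real) \<Rightarrow> covar \<times> real \<Rightarrow> real" where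
  "sq_loss_diff f1 f2 z = (f1 (fst z) - snd z)\<^sup>2 - (f2 (fst z) - snd z)\<^sup>2"

text \<open>The difference of squares factors as (a + b - 2 y) (a - b). The first factor is at most
  4 K in absolute value, the second is compared through \<open>c\<close>, and 16 * 2 = 32. In the
  application \<open>c\<close> is the regression value.\<close>

lemma sq_loss_diff_sq_le:
  fixes a b y c K :: real
  assumes "\<bar>a\<bar> \<le> K" "\<bar>b\<bar> \<le> K" "\<bar>y\<bar> \<le> K"
  shows "((a - y)\<^sup>2 - (b - y)\<^sup>2)\<^sup>2 \<le> 32 * K\<^sup>2 * ((a - c)\<^sup>2 + (b - c)\<^sup>2)"
proof -
  have e: "(a - y)\<^sup>2 - (b - y)\<^sup>2 = (a + b - 2 * y) * (a - b)"
    by (simp add: power2_eq_square algebra_simps)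
  have "\<bar>a + b - 2 * y\<bar> \<le> 4 * K" using assms by linarith
  then have "(a + b - 2 * y)\<^sup>2 \<le> (4 * K)\<^sup>2" using abs_le_square_iff[of "a + b - 2 * y" "4 * K"] by simp
  moreover have "(a - b)\<^sup>2 \<le> 2 * ((a - c)\<^sup>2 + (b - c)\<^sup>2)"
    using zero_le_power2[of "a + b - 2 * c"] by (simp add: power2_eq_square algebra_simps)
  ultimately have "(a + b - 2 * y)\<^sup>2 * (a - b)\<^sup>2 \<le> (4 * K)\<^sup>2 * (2 * ((a - c)\<^sup>2 + (b - c)\<^sup>2))"
    by (intro mult_mono) auto
  also have "\<dots> = 32 * K\<^sup>2 * ((a - c)\<^sup>2 + (b - c)\<^sup>2)"
    by (simp add: power_mult_distrib)
  finally show ?thesis unfolding e power_mult_distrib .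
qed

text \<open>The second moment vanishes with the excess risks, however noisy the response is; this is
  why the rate is 1 / n and not 1 / sqrt n. The Bayes risk cancels in the mean of the
  difference.\<close>

lemma second_moment_sq_loss_diff:
  assumes P: "prob_space P" and sets: "sets P = sets (borel :: (covar \<times> real) measure)"
    and f: "f1 \<in> borel_measurable borel" "f2 \<in> borel_measurable borel"
    and b: "AE z in P. \<bar>f1 (fst z)\<bar> \<le> K" "AE z in P. \<bar>f2 (fst z)\<bar> \<le> K" and bY: "AE z in P. \<bar>snd z\<bar> \<le> K"
  shows "(\<integral>z. (sq_loss_diff f1 f2 z)\<^sup>2 \<partial>P) \<le> 32 * K\<^sup>2 * (excess_risk P f1 + excess_risk P f2)"
    and "0 \<le> excess_risk P f1" "0 \<le> excess_risk P f2"
    and "(\<integral>z. sq_loss_diff f1 f2 z \<partial>P) = excess_risk P f1 - excess_risk P f2"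
proof -
  interpret P: prob_space P by fact
  define c where "c = real_cond_exp P (vimage_algebra (space P) fst borel) snd"
  note e1 = excess_risk_eq_sq_dist[OF P sets f(1) b(1) bY, folded c_def]
  note e2 = excess_risk_eq_sq_dist[OF P sets f(2) b(2) bY, folded c_def]
  show "0 \<le> excess_risk P f1" "0 \<le> excess_risk P f2" unfolding e1(1) e2(1) by auto
  have fstm[measurable]: "fst \<in> P \<rightarrow>\<^sub>M (borel :: covar measure)"
    and sndm[measurable]: "snd \<in> borel_measurable P"
    unfolding measurable_cong_sets[OF sets refl]
    by (intro borel_measurable_continuous_onI continuous_on_fst continuous_on_snd continuous_on_id)+
  have [measurable]: "(\<lambda>z. f1 (fst z)) \<in> borel_measurable P" "(\<lambda>z. f2 (fst z)) \<in> borel_measurable P"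
    using measurable_compose[OF fstm f(1)] measurable_compose[OF fstm f(2)] by auto
  have [measurable]: "c \<in> borel_measurable P" by (simp add: c_def)
  have sq: "integrable P (\<lambda>z. (p z - q z)\<^sup>2)"
    if "p \<in> borel_measurable P" "q \<in> borel_measurable P"
      "AE z in P. \<bar>p z\<bar> \<le> K" "AE z in P. \<bar>q z\<bar> \<le> K" for p q :: "covar \<times> real \<Rightarrow> real"
  proof (rule P.integrable_const_bound[where B = "(2 * K)\<^sup>2"])
    show "AE z in P. norm ((p z - q z)\<^sup>2) \<le> (2 * K)\<^sup>2"
      using that(3,4)
    proof eventually_elim
      case (elim z)
      then have "\<bar>p z - q z\<bar> \<le> \<bar>2 * K\<bar>" by linarith
      then show ?case unfolding abs_le_square_iff by simp
    qed
  qed (use that in auto)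
  have i: "integrable P (\<lambda>z. (f1 (fst z) - c z)\<^sup>2)" "integrable P (\<lambda>z. (f2 (fst z) - c z)\<^sup>2)"
    "integrable P (\<lambda>z. (f1 (fst z) - snd z)\<^sup>2)" "integrable P (\<lambda>z. (f2 (fst z) - snd z)\<^sup>2)"
    by (rule sq; (rule b bY e1(2) | measurable))+
  show "(\<integral>z. sq_loss_diff f1 f2 z \<partial>P) = excess_risk P f1 - excess_risk P f2"
    using i by (simp add: sq_loss_diff_def[abs_def] excess_risk_def risk_def)
  have "(\<integral>z. (sq_loss_diff f1 f2 z)\<^sup>2 \<partial>P)
      \<le> (\<integral>z. 32 * K\<^sup>2 * ((f1 (fst z) - c z)\<^sup>2 + (f2 (fst z) - c z)\<^sup>2) \<partial>P)"
  proof (rule integral_mono_AE')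
    show "integrable P (\<lambda>z. 32 * K\<^sup>2 * ((f1 (fst z) - c z)\<^sup>2 + (f2 (fst z) - c z)\<^sup>2))"
      using i by simp
    show "AE z in P. (sq_loss_diff f1 f2 z)\<^sup>2 \<le> 32 * K\<^sup>2 * ((f1 (fst z) - c z)\<^sup>2 + (f2 (fst z) - c z)\<^sup>2)"
      using b bY by eventually_elim (simp only: sq_loss_diff_def sq_loss_diff_sq_le)
  qed auto
  also have "\<dots> = 32 * K\<^sup>2 * (excess_risk P f1 + excess_risk P f2)"
    using i by (simp add: e1(1) e2(1))
  finally show "(\<integral>z. (sq_loss_diff f1 f2 z)\<^sup>2 \<partial>P) \<le> 32 * K\<^sup>2 * (excess_risk P f1 + excess_risk P f2)" .
qed

section \<open>The selection rule\<close>

text \<open>First \<phi> l <= 2 b, since all windows up to \<open>l\<close> share the bias bound and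
  their noise is covered by the radii. Whichever of \<open>k\<close> and \<open>l\<close> is longer,
  its own \<phi> controls |D k - D l|, and the inequality between the two criteria turns this into 2
  (\<phi> l + \<psi> l). Adding |D l - \<theta>| <= \<psi> l + b gives the factors 3 and 5.\<close>

lemma lepski_selection:
  fixes D \<mu> \<psi> \<phi> :: "nat \<Rightarrow> real" and \<theta> b :: real
  assumes \<phi>: "\<And>k. \<phi> k = Max ((\<lambda>i. max 0 (\<bar>D k - D i\<bar> - (\<psi> k + \<psi> i))) ` {1..k})"
    and conc: "\<And>i. i \<in> {1..m} \<Longrightarrow> \<bar>D i - \<mu> i\<bar> \<le> \<psi> i"
    and l: "l \<in> {1..m}" and bias: "\<And>i. i \<in> {1..l} \<Longrightarrow> \<bar>\<mu> i - \<theta>\<bar> \<le> b"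
    and k: "k \<in> {1..m}" "\<phi> k + \<psi> k \<le> \<phi> l + \<psi> l"
  shows "\<bar>D k - \<theta>\<bar> \<le> 3 * \<psi> l + 5 * b"
proof -
  have lower: "\<bar>D p - D i\<bar> \<le> \<phi> p + \<psi> p + \<psi> i" if "i \<in> {1..p}" for p i
  proof -
    have "max 0 (\<bar>D p - D i\<bar> - (\<psi> p + \<psi> i)) \<le> \<phi> p"
      unfolding \<phi> using that by (intro Max_ge) auto
    then show ?thesis by linarith
  qed
  have nonneg: "0 \<le> \<phi> p" if "p \<in> {1..m}" for p
  proof -
    have "max 0 (\<bar>D p - D p\<bar> - (\<psi> p + \<psi> p)) \<le> \<phi> p"
      unfolding \<phi> using that by (intro Max_ge rev_image_eqI[of p]) auto
    then show ?thesis by linarith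
  qed
  have bl: "\<bar>\<mu> l - \<theta>\<bar> \<le> b" using l by (intro bias) auto
  then have b: "0 \<le> b" by linarith
  have "\<phi> l \<le> 2 * b"
    unfolding \<phi>
  proof (rule Max.boundedI)
    fix a assume "a \<in> (\<lambda>i. max 0 (\<bar>D l - D i\<bar> - (\<psi> l + \<psi> i))) ` {1..l}"
    then obtain i where i: "i \<in> {1..l}" "a = max 0 (\<bar>D l - D i\<bar> - (\<psi> l + \<psi> i))" by auto
    have "i \<in> {1..m}" using i l by auto
    from conc[OF this] conc[OF l] bias[OF i(1)] bl
    have "\<bar>D l - D i\<bar> - (\<psi> l + \<psi> i) \<le> 2 * b" by linarith
    then show "a \<le> 2 * b" using b by (simp add: i)
  qed (use l in auto)
  moreover have "\<bar>D k - D l\<bar> \<le> 2 * (\<phi> l + \<psi> l)"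
  proof (cases "l \<le> k")
    case True
    then show ?thesis using lower[of l k] k l nonneg[OF l] by auto
  next
    case False
    then show ?thesis using lower[of k l] k l nonneg[OF k(1)] by (auto simp: abs_minus_commute)
  qed
  ultimately show ?thesis
    using conc[OF l] bl unfolding abs_le_iff by argo
qed

lemma psi_bound_arith:
  fixes N M L Q v W \<tau> :: real
  assumes N: "2 \<le> N" and L: "0 \<le> L" and W: "0 \<le> W" and \<tau>: "0 \<le> \<tau>"
    and v: "0 \<le> v" "v\<^sup>2 \<le> Q / (N - 1)"
    and Q: "0 \<le> Q" "Q \<le> 2 * (N * (32 * M\<^sup>2 * W + 32 * M^4 * \<tau>)) + 16 * M^4 * L"
  shows "v * sqrt (2 * L / N) + 64 * M\<^sup>2 * L / (3 * (N - 1)) \<le> W / 6 + M\<^sup>2 * \<tau> + 811 * (M\<^sup>2 * L / N)"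
proof -
  define \<beta> where "\<beta> = M\<^sup>2 * L / N"
  define T where "T = M\<^sup>2 * \<tau>"
  have \<beta>: "0 \<le> \<beta>" "0 \<le> T" using N L \<tau> by (auto simp: \<beta>_def T_def)
  have "v\<^sup>2 \<le> Q * (2 / N)"
  proof -
    have "Q / (N - 1) \<le> Q / (N / 2)" using Q N by (intro divide_left_mono) auto
    then show ?thesis using v by (simp add: mult.commute)
  qed
  then have "v\<^sup>2 * (2 * L / N) \<le> Q * (2 / N) * (2 * L / N)"
    using L N by (intro mult_right_mono) auto
  also have "\<dots> \<le> (2 * (N * (32 * M\<^sup>2 * W + 32 * M^4 * \<tau>)) + 16 * M^4 * L) * (2 / N) * (2 * L / N)"
    using Q L N by (intro mult_right_mono) auto
  also have "\<dots> = 256 * \<beta> * W + 256 * \<beta> * T + 64 * \<beta>\<^sup>2"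
    using N by (simp add: \<beta>_def T_def field_simps power2_eq_square power4_eq_xxxx)
  \<comment> \<open>AM-GM weights: 2 * (1/6) * 768 = 256 absorbs the mixed term with
    \<open>W\<close>. The weight 1/6 is dictated by the factor 3 of \<open>lepski_selection\<close>,
    so that W / 2 remains; 811 rounds up 768 + 128/3.\<close>
  also have "\<dots> \<le> (W / 6 + T + 768 * \<beta>)\<^sup>2"
  proof -
    have "0 \<le> W * W" "0 \<le> T * T" "0 \<le> W * T" "0 \<le> \<beta> * T" "0 \<le> \<beta> * \<beta>" using W \<beta> by auto
    then show ?thesis by (simp add: power2_eq_square algebra_simps)
  qed
  finally have "(v * sqrt (2 * L / N))\<^sup>2 \<le> (W / 6 + T + 768 * \<beta>)\<^sup>2"
    using N L by (simp add: power_mult_distrib)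
  then have 1: "v * sqrt (2 * L / N) \<le> W / 6 + T + 768 * \<beta>"
    by (rule power2_le_imp_le) (use W \<beta> in auto)
  have "64 * M\<^sup>2 * L / (3 * (N - 1)) \<le> 64 * M\<^sup>2 * L / (3 * (N / 2))"
    using N L by (intro divide_left_mono) auto
  also have "\<dots> = 128 / 3 * \<beta>" by (simp add: \<beta>_def)
  finally have "64 * M\<^sup>2 * L / (3 * (N - 1)) \<le> 128 / 3 * \<beta>" .
  with 1 \<beta> have "v * sqrt (2 * L / N) + 64 * M\<^sup>2 * L / (3 * (N - 1)) \<le> W / 6 + T + 811 * \<beta>" by linarith
  then show ?thesis by (simp add: \<beta>_def T_def)
qed

section \<open>Windows as index sets of observations\<close>

definition window :: "(nat \<Rightarrow> nat) \<Rightarrow> nat \<Rightarrow> nat \<Rightarrow> (nat \<times> nat) set" where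
  "window n t l = Sigma {t-l..t-1} (\<lambda>j. {1..n j})"

lemma finite_window: "finite (window n t l)"
  by (simp add: window_def)

lemma card_window: "card (window n t l) = n_win n t l"
  by (simp add: window_def n_win_def)

text \<open>Brings the double sums of the procedure into the form used by the concentration bounds,
  a sum over coordinates of the product space.\<close>

lemma sum_window: "(\<Sum>j\<in>{t-l..t-1}. \<Sum>i\<in>{1..n j}. g (j, i)) = (\<Sum>k\<in>window n t l. g k)"
  unfolding window_def by (subst sum.Sigma) (auto simp: case_prod_unfold)

lemma u_val_eq: "u_val f1 f2 D j i = sq_loss_diff f1 f2 (D (j, i))"
  by (simp add: u_val_def sq_loss_diff_def)

lemma Delta_hat_eq:
  "Delta_hat f1 f2 D n t l = (\<Sum>k\<in>window n t l. sq_loss_diff f1 f2 (D k)) / real (n_win n t l)"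
  unfolding Delta_hat_def u_val_eq sum_window[where g = "\<lambda>k. sq_loss_diff f1 f2 (D k)"] ..

lemma v_hat_eq:
  "v_hat f1 f2 D n t l = sqrt ((\<Sum>k\<in>window n t l. (sq_loss_diff f1 f2 (D k) - Delta_hat f1 f2 D n t l)\<^sup>2)
     / (real (n_win n t l) - 1))"
  unfolding v_hat_def u_val_eq
    sum_window[where g = "\<lambda>k. (sq_loss_diff f1 f2 (D k) - Delta_hat f1 f2 D n t l)\<^sup>2"] ..

lemma n_win_pos:
  assumes "\<And>j. 1 \<le> n j" "l \<in> {1..t-1}"
  shows "1 \<le> n_win n t l"
proof -
  have "n (t-1) \<le> n_win n t l"
    unfolding n_win_def using assms(2) by (intro member_le_sum) auto
  then show ?thesis using assms(1)[of "t-1"] by linarith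
qed

text \<open>Here m and q stand for the period means of the loss difference and of its square; the
  variance term is absorbed because e1 + e2 = 2 * min e1 e2 + \<bar>e1 - e2\<bar>.\<close>

lemma selection_oracle_inequality:
  fixes e1 e2 M L \<tau> :: real and m :: "nat \<Rightarrow> real"
  assumes n: "\<And>j. 1 \<le> n j" and M: "1 \<le> M" and L: "1 \<le> L" "L = ln (2 / \<delta>')"
    and e: "0 \<le> e1" "0 \<le> e2" and l: "l \<in> {1..t-1}" and \<tau>: "0 \<le> \<tau>"
    and conc: "\<And>i. i \<in> {1..t-1} \<Longrightarrow>
      \<bar>Delta_hat f1 f2 D n t i - (\<Sum>k\<in>window n t i. m (fst k)) / real (n_win n t i)\<bar> \<le> psi_hat f1 f2 D n M \<delta>' t i"
    and second: "(\<Sum>k\<in>window n t l. (sq_loss_diff f1 f2 (D k))\<^sup>2) \<le> 2 * (\<Sum>k\<in>window n t l. q (fst k)) + 16 * M^4 * L"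
    and m: "\<And>j. j \<in> {t-l..t-1} \<Longrightarrow> \<bar>m j - (e1 - e2)\<bar> \<le> 8 * M\<^sup>2 * \<tau>"
    and q: "\<And>j. j \<in> {t-l..t-1} \<Longrightarrow> q j \<le> 32 * M\<^sup>2 * (e1 + e2) + 32 * M^4 * \<tau>"
    and lh: "is_lhat f1 f2 D n M \<delta>' t lh"
  shows "(if Delta_hat f1 f2 D n t lh \<le> 0 then e1 else e2)
    \<le> 3 * min e1 e2 + 86 * (M\<^sup>2 * \<tau>) + 4866 * (M\<^sup>2 * L / real (n_win n t l))"
proof -
  define N where "N = real (n_win n t l)"
  have N: "1 \<le> N" using n_win_pos[of n l t] n l by (simp add: N_def)
  define W where "W = e1 + e2"
  have psi: "psi_hat f1 f2 D n M \<delta>' t l \<le> W / 6 + M\<^sup>2 * \<tau> + 811 * (M\<^sup>2 * L / N)"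
  proof (cases "n_win n t l = 1")
    case True
    \<comment> \<open>The default radius 8 M^2 of a single observation is absorbed by 811 M^2 L
      because L >= 1.\<close>
    have "M\<^sup>2 * 1 \<le> M\<^sup>2 * L" using L by (intro mult_left_mono) auto
    moreover have "0 \<le> M\<^sup>2 * \<tau>" "0 \<le> W" using \<tau> e by (auto simp: W_def)
    ultimately have "8 * M\<^sup>2 \<le> W / 6 + M\<^sup>2 * \<tau> + 811 * (M\<^sup>2 * L)"
      using zero_le_power2[of M] by linarith
    then show ?thesis using True by (simp add: psi_hat_def N_def)
  next
    case False
    then have N2: "2 \<le> N" using N by (simp add: N_def)
    define Q where "Q = (\<Sum>k\<in>window n t l. (sq_loss_diff f1 f2 (D k))\<^sup>2)"
    have ne: "window n t l \<noteq> {}" using N by (auto simp: N_def card_window[symmetric])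
    have "(v_hat f1 f2 D n t l)\<^sup>2 \<le> Q / (N - 1)"
    proof -
      have "(\<Sum>k\<in>window n t l. (sq_loss_diff f1 f2 (D k) - Delta_hat f1 f2 D n t l)\<^sup>2) \<le> Q"
        using sum_square_deviation[OF finite_window ne, of "\<lambda>k. sq_loss_diff f1 f2 (D k)" 0]
        by (simp add: Q_def Delta_hat_eq card_window)
      moreover have "0 \<le> (\<Sum>k\<in>window n t l. (sq_loss_diff f1 f2 (D k) - Delta_hat f1 f2 D n t l)\<^sup>2)"
        by (intro sum_nonneg) auto
      ultimately show ?thesis
        unfolding v_hat_eq using N2 by (subst real_sqrt_pow2) (auto simp: N_def intro: divide_right_mono)
    qed
    moreover have "0 \<le> v_hat f1 f2 D n t l"
      unfolding v_hat_eq using N by (auto simp: N_def intro!: divide_nonneg_nonneg sum_nonneg)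
    moreover have "Q \<le> 2 * (N * (32 * M\<^sup>2 * W + 32 * M^4 * \<tau>)) + 16 * M^4 * L"
    proof -
      have "(\<Sum>k\<in>window n t l. q (fst k)) \<le> real (card (window n t l)) * (32 * M\<^sup>2 * W + 32 * M^4 * \<tau>)"
        by (rule sum_bounded_above) (use q in \<open>auto simp: window_def W_def\<close>)
      then show ?thesis using second by (simp add: Q_def N_def card_window)
    qed
    moreover have "0 \<le> Q" unfolding Q_def by (intro sum_nonneg) auto
    ultimately show ?thesis
      using False N2 L e \<tau> psi_bound_arith[of N L W \<tau> "v_hat f1 f2 D n t l" Q M]
      by (simp add: psi_hat_def N_def W_def)
  qed
  have dev: "\<bar>Delta_hat f1 f2 D n t lh - (e1 - e2)\<bar> \<le> 3 * psi_hat f1 f2 D n M \<delta>' t l + 5 * (8 * M\<^sup>2 * \<tau>)"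
  proof (rule lepski_selection[where m = "t - 1" and l = l
        and \<phi> = "phi_hat f1 f2 D n M \<delta>' t" and D = "Delta_hat f1 f2 D n t"
        and \<mu> = "\<lambda>i. (\<Sum>k\<in>window n t i. m (fst k)) / real (n_win n t i)"])
    show "lh \<in> {1..t-1}" "phi_hat f1 f2 D n M \<delta>' t lh + psi_hat f1 f2 D n M \<delta>' t lh
        \<le> phi_hat f1 f2 D n M \<delta>' t l + psi_hat f1 f2 D n M \<delta>' t l"
      using lh l by (auto simp: is_lhat_def crit_def)
    \<comment> \<open>A shorter window is contained in window \<open>l\<close>, so the drift bound
      of \<open>l\<close> applies to its mean as well.\<close>
    fix i assume i: "i \<in> {1..l}"
    have Ni: "1 \<le> real (n_win n t i)" using n_win_pos[of n i t] n l i by simp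
    have "\<bar>\<Sum>k\<in>window n t i. m (fst k) - (e1 - e2)\<bar> \<le> (\<Sum>k\<in>window n t i. \<bar>m (fst k) - (e1 - e2)\<bar>)"
      by (rule sum_abs)
    also have "\<dots> \<le> real (card (window n t i)) * (8 * M\<^sup>2 * \<tau>)"
      by (rule sum_bounded_above) (use m i in \<open>auto simp: window_def\<close>)
    finally have "\<bar>(\<Sum>k\<in>window n t i. m (fst k)) - real (n_win n t i) * (e1 - e2)\<bar> \<le> real (n_win n t i) * (8 * M\<^sup>2 * \<tau>)"
      by (simp add: sum_subtractf card_window)
    moreover have "(\<Sum>k\<in>window n t i. m (fst k)) / real (n_win n t i) - (e1 - e2)
        = ((\<Sum>k\<in>window n t i. m (fst k)) - real (n_win n t i) * (e1 - e2)) / real (n_win n t i)"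
      using Ni by (simp add: diff_divide_distrib)
    ultimately show "\<bar>(\<Sum>k\<in>window n t i. m (fst k)) / real (n_win n t i) - (e1 - e2)\<bar> \<le> 8 * M\<^sup>2 * \<tau>"
      using Ni by (simp add: abs_divide divide_le_eq mult.commute)
  qed (use l conc in \<open>auto simp: phi_hat_def\<close>)
  define T where "T = M\<^sup>2 * \<tau>"
  define \<beta> where "\<beta> = M\<^sup>2 * L / N"
  have nn: "0 \<le> T" "0 \<le> \<beta>" using \<tau> L N by (auto simp: T_def \<beta>_def)
  \<comment> \<open>The constants are 3 * (1/6) = 1/2, 3 + 5 * 8 = 43 and 3 * 811 = 2433.\<close>
  have "\<bar>Delta_hat f1 f2 D n t lh - (e1 - e2)\<bar> \<le> (e1 + e2) / 2 + 43 * T + 2433 * \<beta>"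
    using dev psi unfolding W_def T_def[symmetric] \<beta>_def[symmetric] mult.assoc by linarith
  \<comment> \<open>As (e1 + e2) / 2 = min e1 e2 + |e1 - e2| / 2, a wrong choice forces |e1 - e2| <=
    2 min e1 e2 + 2 R with R the remainder; the larger risk is the minimum plus this gap.\<close>
  then have "(if Delta_hat f1 f2 D n t lh \<le> 0 then e1 else e2) \<le> 3 * min e1 e2 + 86 * T + 4866 * \<beta>"
    using e nn unfolding abs_le_iff min_def by argo
  then show ?thesis unfolding T_def \<beta>_def N_def .
qed

section \<open>The concentration event\<close>

text \<open>Independence is read off from the joint law, which for the coordinates is the product
  measure itself. This criterion is for nonempty families, hence the case split.\<close>

lemma indep_vars_PiM_coordinates:
  assumes "\<And>i. i \<in> I \<Longrightarrow> prob_space (M i)"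
  shows "prob_space.indep_vars (PiM I M) M (\<lambda>i \<omega>. \<omega> i) I"
proof (cases "I = {}")
  case True
  interpret prob_space "PiM I M" by (rule prob_space_PiM) (use assms in auto)
  show ?thesis unfolding indep_vars_def indep_sets_def by (simp add: True)
next
  case False
  interpret prob_space "PiM I M" by (rule prob_space_PiM) (use assms in auto)
  have "distr (PiM I M) (PiM I M) (\<lambda>\<omega>. \<lambda>i\<in>I. \<omega> i) = distr (PiM I M) (PiM I M) (\<lambda>\<omega>. \<omega>)"
    by (rule distr_cong) (auto simp: space_PiM)
  also have "\<dots> = PiM I M" by (rule distr_id)
  also have "\<dots> = PiM I (\<lambda>i. distr (PiM I M) (M i) (\<lambda>\<omega>. \<omega> i))"
    by (rule PiM_cong) (auto simp: distr_PiM_component assms)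
  finally show ?thesis
    by (subst indep_vars_iff_distr_eq_PiM') (use False in auto)
qed

lemma integral_PiM_component:
  fixes g :: "'a \<Rightarrow> real"
  assumes "\<And>i. i \<in> I \<Longrightarrow> prob_space (M i)" "i \<in> I" "g \<in> borel_measurable (M i)"
  shows "(\<integral>\<omega>. g (\<omega> i) \<partial>PiM I M) = (\<integral>z. g z \<partial>M i)"
proof -
  have "(\<integral>z. g z \<partial>M i) = (\<integral>z. g z \<partial>distr (PiM I M) (M i) (\<lambda>\<omega>. \<omega> i))"
    using distr_PiM_component[of I M i] assms(1,2) by simp
  also have "\<dots> = (\<integral>\<omega>. g (\<omega> i) \<partial>PiM I M)"
    using assms(2,3) by (intro integral_distr) auto
  finally show ?thesis ..
qed

lemma measurable_sq_loss_diff: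
  assumes sets: "sets P = sets (borel :: (covar \<times> real) measure)"
    and f: "f1 \<in> borel_measurable borel" "f2 \<in> borel_measurable borel"
  shows "sq_loss_diff f1 f2 \<in> borel_measurable P"
proof -
  have [measurable]: "fst \<in> P \<rightarrow>\<^sub>M (borel :: covar measure)" "snd \<in> borel_measurable P"
    unfolding measurable_cong_sets[OF sets refl]
    by (intro borel_measurable_continuous_onI continuous_on_fst continuous_on_snd continuous_on_id)+
  note [measurable] = f
  show ?thesis unfolding sq_loss_diff_def[abs_def] by measurable
qed

text \<open>Both squares lie in [0, 4 M^2], so their difference is bounded by 4 M^2 and not merely
  by 8 M^2; the constant of \<open>psi_hat\<close> relies on this.\<close>

lemma abs_sq_loss_diff_le:
  assumes "\<bar>f1 (fst z)\<bar> \<le> M" "\<bar>f2 (fst z)\<bar> \<le> M" "\<bar>snd z\<bar> \<le> M"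
  shows "\<bar>sq_loss_diff f1 f2 z\<bar> \<le> 4 * M\<^sup>2"
proof -
  have "\<bar>a - snd z\<bar> \<le> \<bar>2 * M\<bar>" if "\<bar>a\<bar> \<le> M" for a using that assms by linarith
  then have "(a - snd z)\<^sup>2 \<le> (2 * M)\<^sup>2" if "\<bar>a\<bar> \<le> M" for a
    using that unfolding abs_le_square_iff by blast
  from this[OF assms(1)] this[OF assms(2)]
  have "(f1 (fst z) - snd z)\<^sup>2 \<in> {0..4 * M\<^sup>2}" "(f2 (fst z) - snd z)\<^sup>2 \<in> {0..4 * M\<^sup>2}"
    by (auto simp: power_mult_distrib)
  then show ?thesis unfolding sq_loss_diff_def atLeastAtMost_iff abs_le_iff by linarith
qed

text \<open>The mean is compared with the average over the laws in the window, not with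
  \<open>P t\<close>: drift is treated deterministically on this event. The second conjunct makes
  the random radius comparable with population moments.\<close>

definition concentrated ::
    "(covar \<Rightarrow> real) \<Rightarrow> (covar \<Rightarrow> real) \<Rightarrow> (nat \<Rightarrow> nat) \<Rightarrow> (nat \<Rightarrow> (covar \<times> real) measure) \<Rightarrow> real \<Rightarrow> real \<Rightarrow> nat \<Rightarrow> nat
      \<Rightarrow> dataset \<Rightarrow> bool" where
  "concentrated f1 f2 n P M \<delta>' t l D \<longleftrightarrow>
     \<bar>Delta_hat f1 f2 D n t l - (\<Sum>k\<in>window n t l. \<integral>z. sq_loss_diff f1 f2 z \<partial>P (fst k)) / real (n_win n t l)\<bar>
       \<le> psi_hat f1 f2 D n M \<delta>' t l \<and>
     (\<Sum>k\<in>window n t l. (sq_loss_diff f1 f2 (D k))\<^sup>2)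
       \<le> 2 * (\<Sum>k\<in>window n t l. \<integral>z. (sq_loss_diff f1 f2 z)\<^sup>2 \<partial>P (fst k)) + 16 * M^4 * ln (2 / \<delta>')"

text \<open>With exp(-L) = \<delta>' / 2, the empirical Bernstein bound costs 3 \<delta>' / 2 and
  the second moment bound \<delta>' / 2.\<close>

lemma window_concentration:
  assumes P: "\<And>j. prob_space (P j)" and sets: "\<And>j. sets (P j) = sets (borel :: (covar \<times> real) measure)"
    and f: "f1 \<in> borel_measurable borel" "f2 \<in> borel_measurable borel"
    and u: "\<And>j. AE z in P j. \<bar>sq_loss_diff f1 f2 z\<bar> \<le> 4 * M\<^sup>2"
    and M: "1 \<le> M" and n: "\<And>j. 1 \<le> n j" and l: "l \<in> {1..t-1}" and \<delta>': "0 < \<delta>'" "\<delta>' < 2"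
  shows "{D \<in> space (data_law P n t). concentrated f1 f2 n P M \<delta>' t l D} \<in> sets (data_law P n t)"
    and "measure (data_law P n t) {D \<in> space (data_law P n t). \<not> concentrated f1 f2 n P M \<delta>' t l D} \<le> 2 * \<delta>'"
proof -
  define I where "I = {(j,i). j \<in> {1..t-1} \<and> i \<in> {1..n j}}"
  define \<Omega> where "\<Omega> = PiM I (\<lambda>k. P (fst k))"
  have law: "data_law P n t = \<Omega>"
    unfolding data_law_def \<Omega>_def I_def by (simp add: case_prod_unfold)
  interpret prob_space \<Omega> unfolding \<Omega>_def by (rule prob_space_PiM) (rule P)
  define U where "U = (\<lambda>k (D::dataset). sq_loss_diff f1 f2 (D k))"
  let ?J = "window n t l"
  have J: "?J \<subseteq> I" "finite ?J" using l by (auto simp: window_def I_def)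
  define N where "N = n_win n t l"
  have N: "card ?J = N" "1 \<le> N" using n_win_pos[of n l t] n l by (auto simp: N_def card_window)
  have um: "sq_loss_diff f1 f2 \<in> borel_measurable (P j)" for j
    by (rule measurable_sq_loss_diff[OF sets f])
  have ind: "indep_vars (\<lambda>_. borel) U ?J"
  proof -
    have "indep_vars (\<lambda>k. P (fst k)) (\<lambda>k D. D k) I"
      unfolding \<Omega>_def by (rule indep_vars_PiM_coordinates) (rule P)
    from indep_vars_subset[OF this J(1)] show ?thesis
      unfolding U_def by (rule indep_vars_compose2) (rule um)
  qed
  then have rv: "\<And>k. k \<in> ?J \<Longrightarrow> U k \<in> borel_measurable \<Omega>"
    by (simp add: indep_vars_def)
  have bd: "AE D in \<Omega>. \<bar>U k D\<bar> \<le> 4 * M\<^sup>2" if "k \<in> ?J" for k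
    unfolding \<Omega>_def U_def
    by (rule AE_PiM_component[where M = "\<lambda>k. P (fst k)"]) (use that J P u in auto)
  have E: "expectation (\<lambda>D. g (sq_loss_diff f1 f2 (D k))) = (\<integral>z. g (sq_loss_diff f1 f2 z) \<partial>P (fst k))"
    if "k \<in> ?J" "g \<in> borel_measurable borel" for k and g :: "real \<Rightarrow> real"
    unfolding \<Omega>_def
    by (rule integral_PiM_component[where M = "\<lambda>k. P (fst k)" and g = "\<lambda>z. g (sq_loss_diff f1 f2 z)"])
       (use that J P measurable_compose[OF um that(2)] in auto)
  have EU: "expectation (U k) = (\<integral>z. sq_loss_diff f1 f2 z \<partial>P (fst k))" if "k \<in> ?J" for k
    using E[OF that, of "\<lambda>x. x"] by (simp add: U_def)
  have EU2: "expectation (\<lambda>D. (U k D)\<^sup>2) = (\<integral>z. (sq_loss_diff f1 f2 z)\<^sup>2 \<partial>P (fst k))" if "k \<in> ?J" for k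
    using E[OF that, of "\<lambda>x. x\<^sup>2"] by (simp add: U_def)
  define L where "L = ln (2 / \<delta>')"
  have L: "0 < L" using \<delta>' by (simp add: L_def)
  have expL: "exp (- L) = \<delta>' / 2" using \<delta>' by (simp add: L_def exp_minus)
  define m where "m = (\<Sum>k\<in>?J. expectation (U k)) / real N"
  define A where "A D \<longleftrightarrow> \<bar>(\<Sum>k\<in>?J. U k D) / real N - m\<bar> \<le> psi_hat f1 f2 D n M \<delta>' t l" for D
  define B where "B D \<longleftrightarrow> (\<Sum>k\<in>?J. (U k D)\<^sup>2) \<le> 2 * (\<Sum>k\<in>?J. expectation (\<lambda>D. (U k D)\<^sup>2)) + 16 * M^4 * L" for D
  have conc: "concentrated f1 f2 n P M \<delta>' t l D \<longleftrightarrow> A D \<and> B D" for D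
    by (simp add: concentrated_def A_def B_def m_def EU EU2 Delta_hat_eq N_def L_def) (simp add: U_def)
  have psi: "psi_hat f1 f2 D n M \<delta>' t l = (if N = 1 then 8 * M\<^sup>2 else
      sqrt ((\<Sum>k\<in>?J. (U k D - (\<Sum>k\<in>?J. U k D) / N)\<^sup>2) / (real N - 1)) * sqrt (2 * L / N)
         + 16 / 3 * (4 * M\<^sup>2) * L / (real N - 1))" for D
    by (simp add: psi_hat_def v_hat_eq Delta_hat_eq N_def L_def U_def)
  have A_sets: "{D \<in> space \<Omega>. A D} \<in> events"
  proof (cases "N = 1")
    case True
    have "Measurable.pred \<Omega> (\<lambda>D. \<bar>(\<Sum>k\<in>?J. U k D) / real N - m\<bar> \<le> 8 * M\<^sup>2)"
      using rv by measurable
    then show ?thesis using True by (simp add: A_def psi pred_def)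
  next
    case False
    then show ?thesis
      unfolding A_def psi pred_def[symmetric] if_not_P[OF False]
      by (intro measurable_bernstein_event rv)
  qed
  have B_sets: "{D \<in> space \<Omega>. B D} \<in> events"
    unfolding B_def using rv by measurable
  show sets_conc: "{D \<in> space (data_law P n t). concentrated f1 f2 n P M \<delta>' t l D} \<in> sets (data_law P n t)"
  proof -
    have "{D \<in> space \<Omega>. A D \<and> B D} = {D \<in> space \<Omega>. A D} \<inter> {D \<in> space \<Omega>. B D}" by blast
    then show ?thesis using sets.Int[OF A_sets B_sets] unfolding law conc by (simp only:)
  qed
  have pA: "prob {D \<in> space \<Omega>. \<not> A D} \<le> 3 * exp (- L)"
  proof (cases "N = 1")
    case False
    then show ?thesis
      unfolding A_def psi m_def if_not_P[OF False]
      by (intro empirical_bernstein[OF J(2) N(1) _ ind bd _ L]) (use N M in auto)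
  next
    case True
    then obtain k where k: "?J = {k}" using N card_1_singletonE by metis
    \<comment> \<open>With a single observation no variance is estimated: the deviation is at most 4
      M^2 + 4 M^2, the default radius.\<close>
    have "\<bar>expectation (U k)\<bar> \<le> 4 * M\<^sup>2"
    proof -
      have "\<bar>expectation (U k)\<bar> \<le> expectation (\<lambda>D. \<bar>U k D\<bar>)" by (rule integral_abs_bound)
      also have "\<dots> \<le> expectation (\<lambda>D. 4 * M\<^sup>2)"
        using bd[of k] rv[of k] k
        by (intro integral_mono_AE integrable_abs integrable_AE_bounded[where B = "4 * M\<^sup>2"]) auto
      finally show ?thesis by (simp add: prob_space)
    qed
    then have "AE D in \<Omega>. A D"
      using bd[of k] k True by (auto simp: A_def psi m_def elim!: eventually_mono)
    then have "prob {D \<in> space \<Omega>. \<not> A D} = 0"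
      using prob_Collect_eq_0[of "\<lambda>D. \<not> A D"] sets.compl_sets[OF A_sets]
      by (simp add: set_diff_eq cong: conj_cong)
    then show ?thesis by simp
  qed
  have pB: "prob {D \<in> space \<Omega>. \<not> B D} \<le> exp (- L)"
  proof -
    have "prob {D \<in> space \<Omega>. \<not> B D} \<le> \<P>(D in \<Omega>. 2 * (\<Sum>k\<in>?J. expectation (\<lambda>D. (U k D)\<^sup>2)) + (16 * M^4) * L \<le> (\<Sum>k\<in>?J. (U k D)\<^sup>2))"
    proof (rule finite_measure_mono)
      show "{D \<in> space \<Omega>. 2 * (\<Sum>k\<in>?J. expectation (\<lambda>D. (U k D)\<^sup>2)) + (16 * M^4) * L \<le> (\<Sum>k\<in>?J. (U k D)\<^sup>2)} \<in> events"
        using rv by measurable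
    qed (auto simp: B_def)
    also have "\<dots> \<le> exp (- L)"
    proof (rule nonneg_sum_upper_tail[OF J(2)])
      show "indep_vars (\<lambda>_. borel) (\<lambda>k D. (U k D)\<^sup>2) ?J"
        by (rule indep_vars_compose2[OF ind]) simp
      fix k assume "k \<in> ?J"
      from bd[OF this] show "AE D in \<Omega>. 0 \<le> (U k D)\<^sup>2 \<and> (U k D)\<^sup>2 \<le> 16 * M^4"
      proof eventually_elim
        case (elim D)
        then have "\<bar>U k D\<bar>\<^sup>2 \<le> (4 * M\<^sup>2)\<^sup>2" by (intro power_mono) auto
        then show ?case by (simp add: power_mult_distrib)
      qed
    qed (use M in auto)
    finally show ?thesis .
  qed
  have nsets: "{D \<in> space \<Omega>. \<not> A D} \<in> events" "{D \<in> space \<Omega>. \<not> B D} \<in> events"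
    using sets.sets_Collect_neg[OF A_sets] sets.sets_Collect_neg[OF B_sets] by auto
  have "prob {D \<in> space \<Omega>. \<not> concentrated f1 f2 n P M \<delta>' t l D}
      \<le> prob ({D \<in> space \<Omega>. \<not> A D} \<union> {D \<in> space \<Omega>. \<not> B D})"
    by (rule finite_measure_mono) (use nsets in \<open>auto simp: conc\<close>)
  also have "\<dots> \<le> prob {D \<in> space \<Omega>. \<not> A D} + prob {D \<in> space \<Omega>. \<not> B D}"
    using nsets by (rule measure_Un_le)
  also have "\<dots> \<le> 2 * \<delta>'" using pA pB by (simp add: expL)
  finally show "measure (data_law P n t) {D \<in> space (data_law P n t). \<not> concentrated f1 f2 n P M \<delta>' t l D} \<le> 2 * \<delta>'"
    by (simp add: law)
qed

text \<open>The union bound over the windows costs at most t * 2 \<delta> / (3 t) = 2 \<delta> / 3.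
  The event is uniform in the window, so it covers the data-dependent choice and every way of
  breaking ties.\<close>

lemma concentration_event:
  assumes P: "\<And>j. prob_space (P j)" and sets: "\<And>j. sets (P j) = sets (borel :: (covar \<times> real) measure)"
    and f: "f1 \<in> borel_measurable borel" "f2 \<in> borel_measurable borel"
    and u: "\<And>j. AE z in P j. \<bar>sq_loss_diff f1 f2 z\<bar> \<le> 4 * M\<^sup>2"
    and M: "1 \<le> M" and n: "\<And>j. 1 \<le> n j" and t: "2 \<le> t" and \<delta>: "0 < \<delta>" "\<delta> < 1"
  obtains A where "A \<in> sets (data_law P n t)" "1 - \<delta> \<le> measure (data_law P n t) A"
    "\<And>D l. D \<in> A \<Longrightarrow> l \<in> {1..t-1} \<Longrightarrow> concentrated f1 f2 n P M (\<delta> / (3 * real t)) t l D"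
proof -
  let ?\<Omega> = "data_law P n t"
  let ?d = "\<delta> / (3 * real t)"
  interpret prob_space ?\<Omega>
    unfolding data_law_def by (rule prob_space_PiM) (use P in auto)
  have d: "0 < ?d" "?d < 2" using \<delta> t by (auto simp: divide_less_eq)
  define G where "G l = {D \<in> space ?\<Omega>. concentrated f1 f2 n P M ?d t l D}" for l
  define B where "B l = {D \<in> space ?\<Omega>. \<not> concentrated f1 f2 n P M ?d t l D}" for l
  have G: "G l \<in> events" and B: "prob (B l) \<le> 2 * ?d" if "l \<in> {1..t-1}" for l
    unfolding G_def B_def by (rule window_concentration[OF P sets f u M n that d])+
  have BG: "B l = space ?\<Omega> - G l" for l by (auto simp: B_def G_def)
  have Bs: "B l \<in> events" if "l \<in> {1..t-1}" for l using G[OF that] by (simp add: BG)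
  define E where "E = (\<Union>l\<in>{1..t-1}. B l)"
  have Es: "E \<in> events" unfolding E_def using Bs by auto
  have "prob E \<le> (\<Sum>l\<in>{1..t-1}. prob (B l))"
    unfolding E_def by (rule finite_measure_subadditive_finite) (use Bs in auto)
  also have "\<dots> \<le> real (card {1..t-1}) * (2 * ?d)"
    by (rule sum_bounded_above) (rule B)
  also have "\<dots> \<le> real t * (2 * ?d)"
    using d by (intro mult_right_mono) auto
  also have "\<dots> \<le> \<delta>" using t \<delta> by simp
  finally have "1 - \<delta> \<le> prob (space ?\<Omega> - E)" using prob_compl[OF Es] by simp
  moreover have "concentrated f1 f2 n P M ?d t l D" if "D \<in> space ?\<Omega> - E" "l \<in> {1..t-1}" for D l
    using that by (auto simp: E_def B_def)
  ultimately show thesis using that[of "space ?\<Omega> - E"] Es by auto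
qed

text \<open>With r = t / \<delta> >= 2 the logarithm of the procedure is log(6 r), and 6 r <= r^4
  because r^3 >= 8. The lower bound 1/2 lets log(t / \<delta>) multiply the total variation term
  too.\<close>

lemma ln_confidence_bounds:
  fixes t :: nat and \<delta> :: real
  assumes t: "2 \<le> t" and \<delta>: "0 < \<delta>" "\<delta> < 1"
  shows "1 / 2 \<le> ln (t / \<delta>)" "1 \<le> ln (2 / (\<delta> / (3 * real t)))"
    "ln (2 / (\<delta> / (3 * real t))) \<le> 4 * ln (t / \<delta>)"
proof -
  define r where "r = t / \<delta>"
  have r: "2 \<le> r" using t \<delta> mult_left_le[of \<delta> 2] by (simp add: r_def le_divide_eq)
  have e: "2 / (\<delta> / (3 * real t)) = 6 * r" by (simp add: r_def)
  have ln2: "1 / 2 \<le> ln (2::real)"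
    using ln_add_one_self_le_self2[of "-1/2::real"] by (simp add: ln_div)
  show "1 / 2 \<le> ln (t / \<delta>)"
    using ln2 r ln_le_cancel_iff[of 2 r] unfolding r_def[symmetric] by linarith
  have "exp 1 \<le> 6 * r" using exp_le r by linarith
  then show "1 \<le> ln (2 / (\<delta> / (3 * real t)))"
    unfolding e using r by (simp add: ln_ge_iff)
  have "(2::real)^3 \<le> r^3" using r by (intro power_mono) auto
  then have "6 * r \<le> r^3 * r" using r by (intro mult_right_mono) auto
  also have "r^3 * r = r^4" by (simp add: power_Suc2[symmetric] eval_nat_numeral)
  finally have "ln (6 * r) \<le> ln (r^4)" using r by simp
  also have "\<dots> = 4 * ln r" using r by (simp add: ln_realpow)
  finally show "ln (2 / (\<delta> / (3 * real t))) \<le> 4 * ln (t / \<delta>)"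
    unfolding e r_def[symmetric] .
qed

section \<open>Assembly of the oracle inequality\<close>

theorem mainTheorem3:
  shows "\<exists>C>0. \<forall>(d::nat) (X::covar set) (P::nat \<Rightarrow> (covar \<times> real) measure) (n::nat \<Rightarrow> nat)
      (M::real) (f1::covar \<Rightarrow> real) (f2::covar \<Rightarrow> real) (\<delta>::real) (t::nat).
    X \<subseteq> {x. \<forall>k\<ge>d. x k = 0} \<and>
    (\<forall>j. prob_space (P j) \<and> sets (P j) = sets (borel :: (covar \<times> real) measure)) \<and>
    (\<forall>j. AE z in P j. fst z \<in> X) \<and>
    M \<ge> 1 \<and> (\<forall>j. AE z in P j. \<bar>snd z\<bar> \<le> M) \<and>
    (\<forall>j. n j \<ge> 1) \<and>
    f1 \<in> borel_measurable borel \<and> f2 \<in> borel_measurable borel \<and>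
    (\<forall>x\<in>X. \<bar>f1 x\<bar> \<le> M \<and> \<bar>f2 x\<bar> \<le> M) \<and>
    t \<ge> 2 \<and> 0 < \<delta> \<and> \<delta> < 1
    \<longrightarrow>
    (\<exists>A\<in>sets (data_law P n t).
       measure (data_law P n t) A \<ge> 1 - \<delta> \<and>
       (\<forall>D\<in>A. \<forall>l. is_lhat f1 f2 D n M (\<delta> / (3 * real t)) t l \<longrightarrow>
          excess_risk (P t) (compare_out f1 f2 D n t l)
            \<le> C * (min (excess_risk (P t) f1) (excess_risk (P t) f2)
                   + M^2 * ln (real t / \<delta>) *
                     Min ((\<lambda>l'. Max ((\<lambda>j. tv_dist (P j) (P t)) ` {t-l'..t-1})
                                 + 1 / real (n_win n t l')) ` {1..t-1}))))"
\<comment> \<open>The constant dominates 3, 86 * 2 = 172 and 4866 * 4 = 19464; the factors 2 and 4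
  come from \<open>ln_confidence_bounds\<close>.\<close>
proof (intro exI[of _ "20000::real"] conjI allI impI, goal_cases)
  case 1
  show ?case by simp
next
  case (2 d X P n M f1 f2 \<delta> t)
  then have P: "\<And>j. prob_space (P j)" and sets: "\<And>j. sets (P j) = sets (borel :: (covar \<times> real) measure)"
    and X: "\<And>j. AE z in P j. fst z \<in> X" and M: "1 \<le> M" and y: "\<And>j. AE z in P j. \<bar>snd z\<bar> \<le> M"
    and n: "\<And>j. 1 \<le> n j" and f: "f1 \<in> borel_measurable borel" "f2 \<in> borel_measurable borel"
    and fX: "\<And>x. x \<in> X \<Longrightarrow> \<bar>f1 x\<bar> \<le> M" "\<And>x. x \<in> X \<Longrightarrow> \<bar>f2 x\<bar> \<le> M"
    and t: "2 \<le> t" and \<delta>: "0 < \<delta>" "\<delta> < 1"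
    by auto
  have b: "AE z in P j. \<bar>f1 (fst z)\<bar> \<le> M" "AE z in P j. \<bar>f2 (fst z)\<bar> \<le> M" for j
    by (rule eventually_mono[OF X fX(1)], assumption, rule eventually_mono[OF X fX(2)], assumption)
  have u: "AE z in P j. \<bar>sq_loss_diff f1 f2 z\<bar> \<le> 4 * M\<^sup>2" for j
    using b[of j] y[of j] by eventually_elim (rule abs_sq_loss_diff_le)
  have um: "sq_loss_diff f1 f2 \<in> borel_measurable (P j)" for j
    by (rule measurable_sq_loss_diff[OF sets f])
  define \<delta>' where "\<delta>' = \<delta> / (3 * real t)"
  define L where "L = ln (2 / \<delta>')"
  define \<Lambda> where "\<Lambda> = ln (t / \<delta>)"
  have \<Lambda>: "1 / 2 \<le> \<Lambda>" "1 \<le> L" "L \<le> 4 * \<Lambda>"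
    unfolding \<Lambda>_def L_def \<delta>'_def by (rule ln_confidence_bounds[OF t \<delta>])+
  define e1 where "e1 = excess_risk (P t) f1"
  define e2 where "e2 = excess_risk (P t) f2"
  note pop = second_moment_sq_loss_diff[OF P sets f b y, of t, folded e1_def e2_def]
  define tv where "tv j = tv_dist (P j) (P t)" for j
  have tv0: "0 \<le> tv j" for j unfolding tv_def by (rule tv_dist_nonneg[OF P P])
  have PP: "sets (P j) = sets (P k)" for j k using sets by simp
  have mean: "\<bar>(\<integral>z. sq_loss_diff f1 f2 z \<partial>P j) - (e1 - e2)\<bar> \<le> 8 * M\<^sup>2 * tv j" for j
  proof -
    have "(\<integral>z. sq_loss_diff f1 f2 z \<partial>P j) - (\<integral>z. sq_loss_diff f1 f2 z \<partial>P t) \<le> 2 * (4 * M\<^sup>2) * tv j"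
      unfolding tv_def by (rule integral_diff_le_tv_dist[OF P P PP um u u]) (use M in auto)
    \<comment> \<open>The comparison of integrals is one-sided; the negated function supplies the
      other half.\<close>
    moreover have "(\<integral>z. - sq_loss_diff f1 f2 z \<partial>P j) - (\<integral>z. - sq_loss_diff f1 f2 z \<partial>P t) \<le> 2 * (4 * M\<^sup>2) * tv j"
      unfolding tv_def
      by (rule integral_diff_le_tv_dist[OF P P PP]) (use um u M in auto)
    ultimately show ?thesis by (simp add: pop(4) abs_le_iff)
  qed
  have u2: "AE z in P j. \<bar>(sq_loss_diff f1 f2 z)\<^sup>2\<bar> \<le> 16 * M^4" for j
    using u[of j]
  proof eventually_elim
    case (elim z)
    then have "\<bar>sq_loss_diff f1 f2 z\<bar>\<^sup>2 \<le> (4 * M\<^sup>2)\<^sup>2" by (intro power_mono) auto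
    then show ?case by (simp add: power_mult_distrib)
  qed
  have second: "(\<integral>z. (sq_loss_diff f1 f2 z)\<^sup>2 \<partial>P j) \<le> 32 * M\<^sup>2 * (e1 + e2) + 32 * M^4 * tv j" for j
  proof -
    have "(\<integral>z. (sq_loss_diff f1 f2 z)\<^sup>2 \<partial>P j) - (\<integral>z. (sq_loss_diff f1 f2 z)\<^sup>2 \<partial>P t) \<le> 2 * (16 * M^4) * tv j"
      unfolding tv_def
      by (rule integral_diff_le_tv_dist[OF P P PP _ u2 u2]) (use um M in auto)
    then show ?thesis using pop(1) by simp
  qed
  obtain A where A: "A \<in> sets (data_law P n t)" "1 - \<delta> \<le> measure (data_law P n t) A"
    "\<And>D l. D \<in> A \<Longrightarrow> l \<in> {1..t-1} \<Longrightarrow> concentrated f1 f2 n P M \<delta>' t l D"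
    by (rule concentration_event[where P = P and n = n, OF P sets f u M n t \<delta>, folded \<delta>'_def]) (rule that)
  show ?case
  proof (intro bexI[of _ A] conjI ballI allI impI)
    fix D lh assume D: "D \<in> A" and lh: "is_lhat f1 f2 D n M (\<delta> / (3 * real t)) t lh"
    let ?F = "\<lambda>l'. Max ((\<lambda>j. tv_dist (P j) (P t)) ` {t-l'..t-1}) + 1 / real (n_win n t l')"
    \<comment> \<open>The bound on the selected model holds with any window as reference, so one
      attaining the minimum is taken.\<close>
    have "Min (?F ` {1..t-1}) \<in> ?F ` {1..t-1}"
      using t by (intro Min_in) auto
    then obtain l where l: "l \<in> {1..t-1}" "Min (?F ` {1..t-1}) = ?F l" by auto
    define \<tau> where "\<tau> = Max (tv ` {t-l..t-1})"
    have tau: "tv j \<le> \<tau>" if "j \<in> {t-l..t-1}" for j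
      unfolding \<tau>_def using that by (intro Max_ge) auto
    have "t - 1 \<in> {t-l..t-1}" using l by auto
    from tau[OF this] tv0[of "t-1"] have tau0: "0 \<le> \<tau>" by linarith
    define N where "N = real (n_win n t l)"
    have N: "1 \<le> N" using n_win_pos[of n l t] n l by (simp add: N_def)
    have "(if Delta_hat f1 f2 D n t lh \<le> 0 then e1 else e2)
        \<le> 3 * min e1 e2 + 86 * (M\<^sup>2 * \<tau>) + 4866 * (M\<^sup>2 * L / real (n_win n t l))"
    proof (rule selection_oracle_inequality[OF n M \<Lambda>(2) L_def pop(2,3) l(1) tau0])
      show "\<bar>Delta_hat f1 f2 D n t i - (\<Sum>k\<in>window n t i. \<integral>z. sq_loss_diff f1 f2 z \<partial>P (fst k)) / real (n_win n t i)\<bar>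
          \<le> psi_hat f1 f2 D n M \<delta>' t i" if "i \<in> {1..t-1}" for i
        using A(3)[OF D that] by (simp add: concentrated_def)
      show "(\<Sum>k\<in>window n t l. (sq_loss_diff f1 f2 (D k))\<^sup>2)
          \<le> 2 * (\<Sum>k\<in>window n t l. \<integral>z. (sq_loss_diff f1 f2 z)\<^sup>2 \<partial>P (fst k)) + 16 * M^4 * L"
        using A(3)[OF D l(1)] by (simp add: concentrated_def L_def)
      show "is_lhat f1 f2 D n M \<delta>' t lh" using lh by (simp add: \<delta>'_def)
      fix j assume "j \<in> {t-l..t-1}"
      from tau[OF this] have "8 * M\<^sup>2 * tv j \<le> 8 * M\<^sup>2 * \<tau>" "32 * M^4 * tv j \<le> 32 * M^4 * \<tau>"
        by (auto intro!: mult_left_mono)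
      with mean[of j] second[of j]
      show "\<bar>(\<integral>z. sq_loss_diff f1 f2 z \<partial>P j) - (e1 - e2)\<bar> \<le> 8 * M\<^sup>2 * \<tau>"
        and "(\<integral>z. (sq_loss_diff f1 f2 z)\<^sup>2 \<partial>P j) \<le> 32 * M\<^sup>2 * (e1 + e2) + 32 * M^4 * \<tau>"
        by linarith+
    qed
    also have "\<dots> \<le> 20000 * (min e1 e2 + M\<^sup>2 * \<Lambda> * (\<tau> + 1 / N))"
    proof -
      define p where "p = M\<^sup>2 * \<tau> * \<Lambda>"
      define q where "q = M\<^sup>2 * \<Lambda> / N"
      have "M\<^sup>2 * \<tau> * 1 \<le> M\<^sup>2 * \<tau> * (2 * \<Lambda>)" using \<Lambda> tau0 by (intro mult_left_mono) auto
      then have "M\<^sup>2 * \<tau> \<le> 2 * p" by (simp add: p_def)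
      moreover have "M\<^sup>2 / N * L \<le> M\<^sup>2 / N * (4 * \<Lambda>)" using \<Lambda> N by (intro mult_left_mono) auto
      then have "M\<^sup>2 * L / N \<le> 4 * q" by (simp add: q_def algebra_simps)
      moreover have "0 \<le> p" "0 \<le> q" "0 \<le> min e1 e2"
        using \<Lambda> N tau0 pop(2,3) by (auto simp: p_def q_def)
      moreover have "M\<^sup>2 * \<Lambda> * (\<tau> + 1 / N) = p + q" by (simp add: p_def q_def algebra_simps)
      ultimately show ?thesis unfolding N_def[symmetric] by argo
    qed
    also have "(if Delta_hat f1 f2 D n t lh \<le> 0 then e1 else e2) = excess_risk (P t) (compare_out f1 f2 D n t lh)"
      by (simp add: compare_out_def e1_def e2_def)
    finally show "excess_risk (P t) (compare_out f1 f2 D n t lh)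
        \<le> 20000 * (min (excess_risk (P t) f1) (excess_risk (P t) f2) + M^2 * ln (real t / \<delta>) * Min (?F ` {1..t-1}))"
      unfolding l(2) e1_def e2_def \<tau>_def tv_def[abs_def] N_def \<Lambda>_def .
  qed (use A in auto)
qed

end
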